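(* Let $d\ge 1$ and $p\ge 1$ be integers. Consider the nonlinear Schrödinger equation on $\mathbb R^d$ $$i\frac{\partial}{\partial t}U=-\Delta U-|U|^{2p}U. \qquad (\mathrm{NLS})$$ Let $a\in\mathbb R$ and $\tilde j=(\tilde j_1,\dots,\tilde j_d)\in(\mathbb Z^2)^d=\mathbb Z^{2d}$, and consider the solution $$\tilde U(t,x)=a\,e^{-i(\tilde j\cdot\lambda)^2t}\prod_{k=1}^d\cos\big((\tilde j_k\cdot\lambda_k)x_k\big)$$ of the linear equation $i\partial_t\tilde U=-\Delta\tilde U$. Provided $|a|\ll1$ (i.e. $|a|$ is sufficiently small), there is a set $\Lambda\subset(1/2,3/2)^{2d}$ of parameters $\lambda$ with $$\operatorname{meas}\Lambda\ \ge\ 1-|a|^{p/6},$$ such that if $\lambda\in\Lambda$, then there is a solution $U$ of (NLS), bifurcating from $\tilde U$, of the form $U(t,x)=e^{-iEt}u(x)$ with $E=E(\lambda)\in\mathbb R$ and with $u$ given by a quasi-periodic cosine series $$u(x)=\sum_{j=(j_1,\dots,j_d)\in(\mathbb Z^2)^d}\hat u(j_1,\dots,j_d)\prod_{k=1}^d\cos\big((j_k\cdot\lambda_k)x_k\big),$$ and satisfying $$U(t,x)=e^{-i[(\tilde j\cdot\lambda)^2+\mathcal O(|a|^{2p})]t}\Big[a\prod_{k=1}^d\cos\big((\tilde j_k\cdot\lambda_k)x_k\big)+\mathcal O(|a|^p)\Big].$$ The nonlinear eigenvalue $E$, as a function of $\lambda$, is $C^1$ on $(1/2,3/2)^{2d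}$.
   Context: Parameters: $\lambda=(\lambda_1,\dots,\lambda_d)$ with $\lambda_k\in(1/2,3/2)^2$, so $\lambda\in(1/2,3/2)^{2d}$; for $j_k\in\mathbb Z^2$, $j_k\cdot\lambda_k$ is the Euclidean inner product in $\mathbb R^2$. For $j=(j_1,\dots,j_d)\in(\mathbb Z^2)^d=\mathbb Z^{2d}$ put $(j\cdot\lambda)^2:=\sum_{k=1}^d(j_k\cdot\lambda_k)^2$. The $\lambda_k$ are assumed irrational: for each $k$, the distance from $j_k\cdot\lambda_k$ to the nearest integer is nonzero for all $j_k\in\mathbb Z^2\setminus\{0\}$. $U$ is complex valued on $\mathbb R\times\mathbb R^d$, $x=(x_1,\dots,x_d)$, and $\operatorname{meas}$ is Lebesgue measure on $\mathbb R^{2d}$. The function $u$ is even in each $x_k$. $\mathcal O(\cdot)$ is understood as $a\to0$, with $d,p,\tilde j$ fixed. The term $\mathcal O(|a|^p)$ is a cosine series of the same quasi-periodic form, whose size is measured by the $\ell^2(\mathbb Z^{2d})$ norm of its coefficients. The eigenvalue $E$ is understood as a function defined on all of $(1/2,3/2)^{2d}$, whose values at $\lambda\in\Lambda$ are the $E$ of the corresponding solutions. *)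

theory Defs
  imports "HOL-Analysis.Analysis"
begin

text \<open>
  The dimension is \<open>CARD('d)\<close>. A frequency parameter \<open>\<lambda>\<close> lies in \<open>real^2^'d\<close> and a lattice index
  \<open>j\<close> in \<open>int^2^'d\<close>; the blocks \<open>\<lambda> $ k\<close> and \<open>j $ k\<close> have two components each.
\<close>

definition int_inner :: "int^2 \<Rightarrow> real^2 \<Rightarrow> real" where
  "int_inner j l = (\<Sum>i\<in>UNIV. of_int (j $ i) * l $ i)"

definition freq_sq :: "int^2^'d \<Rightarrow> real^2^'d \<Rightarrow> real" where
  "freq_sq j lam = (\<Sum>k\<in>UNIV. (int_inner (j $ k) (lam $ k))\<^sup>2)"

definition param_cube :: "(real^2^'d) set" where
  "param_cube = {lam. \<forall>k i. 1/2 < lam $ k $ i \<and> lam $ k $ i < 3/2}"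

definition irrational_param :: "real^2^'d \<Rightarrow> bool" where
  "irrational_param lam \<longleftrightarrow>
     (\<forall>k. \<forall>j::int^2. j \<noteq> 0 \<longrightarrow> infdist (int_inner j (lam $ k)) \<int> \<noteq> 0)"

definition cos_mode :: "real^2^'d \<Rightarrow> int^2^'d \<Rightarrow> real^'d \<Rightarrow> real" where
  "cos_mode lam j x = (\<Prod>k\<in>UNIV. cos (int_inner (j $ k) (lam $ k) * x $ k))"

text \<open>
  Unconditional convergence at \<open>x = 0\<close>, where every mode equals 1, makes the coefficients
  absolutely summable, hence also square summable.
\<close>
definition cosine_series :: "real^2^'d \<Rightarrow> (int^2^'d \<Rightarrow> complex) \<Rightarrow> (real^'d \<Rightarrow> complex) \<Rightarrow> bool" where
  "cosine_series lam c u \<longleftrightarrow>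
     (\<forall>x. ((\<lambda>j. c j * of_real (cos_mode lam j x)) has_sum u x) UNIV)"

definition l2_norm :: "(int^2^'d \<Rightarrow> complex) \<Rightarrow> real" where
  "l2_norm c = sqrt (\<Sum>\<^sub>\<infinity>j. (norm (c j))\<^sup>2)"

text \<open>
  Classical solutions, continuously differentiable in time and twice continuously differentiable
  in space, of \<open>i \<partial>\<^sub>t U = - \<Delta>U - N(U)\<close>. Here \<open>D k\<close> and \<open>D2 k l\<close> are the first and second
  partial derivatives in space.
\<close>
definition schroedinger_solution ::
    "(complex \<Rightarrow> complex) \<Rightarrow> (real \<Rightarrow> real^'d \<Rightarrow> complex) \<Rightarrow> bool" where
  "schroedinger_solution N U \<longleftrightarrow>
     (\<exists>Ut D D2.
        (\<forall>t x. ((\<lambda>s. U s x) has_vector_derivative Ut t x) (at t)) \<and>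
        (\<forall>k t x. ((\<lambda>s. U t (x + s *\<^sub>R axis k 1)) has_vector_derivative D k t x) (at 0)) \<and>
        (\<forall>k l t x. ((\<lambda>s. D k t (x + s *\<^sub>R axis l 1)) has_vector_derivative D2 k l t x) (at 0)) \<and>
        continuous_on UNIV (\<lambda>(t, x). U t x) \<and>
        continuous_on UNIV (\<lambda>(t, x). Ut t x) \<and>
        (\<forall>k. continuous_on UNIV (\<lambda>(t, x). D k t x)) \<and>
        (\<forall>k l. continuous_on UNIV (\<lambda>(t, x). D2 k l t x)) \<and>
        (\<forall>t x. \<i> * Ut t x = - (\<Sum>k\<in>UNIV. D2 k k t x) - N (U t x)))"

definition NLS_solution :: "nat \<Rightarrow> (real \<Rightarrow> real^'d \<Rightarrow> complex) \<Rightarrow> bool" where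
  "NLS_solution p U \<longleftrightarrow> schroedinger_solution (\<lambda>z. of_real (norm z ^ (2 * p)) * z) U"

definition linear_wave ::
    "real \<Rightarrow> int^2^'d \<Rightarrow> real^2^'d \<Rightarrow> real \<Rightarrow> real^'d \<Rightarrow> complex" where
  "linear_wave a j lam t x =
     of_real a * exp (- \<i> * of_real (freq_sq j lam * t)) * of_real (cos_mode lam j x)"

text \<open>
  \<open>U\<close> and \<open>V\<close> agree, up to a shift of the time frequency by at most \<open>\<epsilon>\<close>, with an error that is
  at each time a cosine series with coefficients of norm at most \<open>\<delta>\<close>. A family of solutions
  \<open>U\<close> bifurcates from \<open>V = linear_wave a j lam\<close> if this holds with \<open>\<epsilon> = o(1)\<close> and
  \<open>\<delta> = o(\<bar>a\<bar>)\<close> as \<open>a \<rightarrow> 0\<close>: the branch leaves 0 at the linear eigenvalue and is tangent to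
  the linear eigenfunction. An error of size \<open>O(\<bar>a\<bar>\<^sup>p)\<close> alone would, for \<open>p = 1\<close>, not even
  exclude \<open>U = 0\<close>.
\<close>
definition close_up_to_freq_shift ::
    "real^2^'d \<Rightarrow> real \<Rightarrow> real \<Rightarrow> (real \<Rightarrow> real^'d \<Rightarrow> complex) \<Rightarrow>
     (real \<Rightarrow> real^'d \<Rightarrow> complex) \<Rightarrow> bool" where
  "close_up_to_freq_shift lam \<epsilon> \<delta> U V \<longleftrightarrow>
     (\<exists>\<theta>. \<bar>\<theta>\<bar> \<le> \<epsilon> \<and>
        (\<forall>t. \<exists>w. l2_norm w \<le> \<delta> \<and>
           cosine_series lam w (\<lambda>x. exp (\<i> * of_real (\<theta> * t)) * U t x - V t x)))"

definition C1_on :: "'a::real_normed_vector set \<Rightarrow> ('a \<Rightarrow> real) \<Rightarrow> bool" where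
  "C1_on S f \<longleftrightarrow>
     (\<exists>f' :: 'a \<Rightarrow> 'a \<Rightarrow>\<^sub>L real.
        (\<forall>x\<in>S. (f has_derivative blinfun_apply (f' x)) (at x)) \<and> continuous_on S f')"

lemma linear_wave_solution:
  fixes j :: "int^2^'d"
  shows "schroedinger_solution (\<lambda>_. 0) (linear_wave a j lam)"
proof -
  define om where "om k = int_inner (j $ k) (lam $ k)" for k
  define h where "h n w y = w ^ n * cos (w * y + real n * (pi / 2))" for n and w y :: real
  define P where "P n x = (\<Prod>m\<in>UNIV. h (n m) (om m) (x $ m))" for n :: "'d \<Rightarrow> nat" and x
  define A where "A t = of_real a * exp (- \<i> * of_real (freq_sq j lam * t))" for t
  have hd: "((\<lambda>y. h n w y) has_real_derivative h (Suc n) w y) (at y)" for n w y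
  proof -
    have "cos (w * y + real (Suc n) * (pi / 2)) = - sin (w * y + real n * (pi / 2))"
      by (simp add: algebra_simps cos_add sin_add add_divide_distrib)
    then show ?thesis
      unfolding h_def by (auto intro!: derivative_eq_intros)
  qed
  have Psplit: "P n (x + s *\<^sub>R axis k 1) =
      h (n k) (om k) (x $ k + s) * (\<Prod>m\<in>UNIV - {k}. h (n m) (om m) (x $ m))" for n x s k
    unfolding P_def by (subst prod.remove[of _ k]) (auto simp: axis_def intro!: prod.cong)
  have Psplit0: "P (n(k := Suc (n k))) x =
      h (Suc (n k)) (om k) (x $ k) * (\<Prod>m\<in>UNIV - {k}. h (n m) (om m) (x $ m))" for n x k
    unfolding P_def by (subst prod.remove[of _ k]) (auto intro!: prod.cong)
  have Pd: "((\<lambda>s. P n (x + s *\<^sub>R axis k 1)) has_real_derivative P (n(k := Suc (n k))) x) (at 0)"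
    for n x k
  proof -
    have "((\<lambda>s. h (n k) (om k) (x $ k + s)) has_real_derivative h (Suc (n k)) (om k) (x $ k)) (at 0)"
      using DERIV_shift[of "h (n k) (om k)" "h (Suc (n k)) (om k) (x $ k)" 0 "x $ k"] hd
      by (simp add: add.commute)
    from DERIV_cmult_right[OF this] show ?thesis
      by (simp only: Psplit Psplit0)
  qed
  have APd: "((\<lambda>s. A t * of_real (P n (x + s *\<^sub>R axis k 1))) has_vector_derivative
      A t * of_real (P (n(k := Suc (n k))) x)) (at 0)" for t n x k
    by (intro has_vector_derivative_mult_right has_vector_derivative_of_real Pd)
  have lw: "linear_wave a j lam t x = A t * of_real (P (\<lambda>_. 0) x)" for t x
    unfolding linear_wave_def A_def P_def h_def cos_mode_def om_def by simp
  have At: "(A has_vector_derivative - \<i> * of_real (freq_sq j lam) * A t) (at t)" for t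
  proof -
    have "((\<lambda>t. of_real a * exp (- \<i> * of_real (freq_sq j lam) * t)) has_field_derivative
       - \<i> * of_real (freq_sq j lam) * A t) (at (of_real t))"
      unfolding A_def by (auto intro!: derivative_eq_intros simp: algebra_simps)
    from has_vector_derivative_real_field[OF this] show ?thesis
      unfolding A_def by (simp add: mult.assoc)
  qed
  have contA: "continuous_on UNIV A"
    unfolding A_def by (intro continuous_intros)
  have contP: "continuous_on UNIV (P n)" for n
    unfolding P_def h_def by (intro continuous_intros)
  have cont: "continuous_on UNIV (\<lambda>(t, x). c * A t * of_real (P n x))" for c n
    unfolding case_prod_unfold
    by (intro continuous_intros continuous_on_compose2[OF contA] continuous_on_compose2[OF contP]) auto
  have P2: "P ((\<lambda>_. 0)(k := Suc (Suc 0))) x = - (om k)\<^sup>2 * P (\<lambda>_. 0) x" for k x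
  proof -
    have h2: "h (Suc (Suc 0)) w y = - w\<^sup>2 * h 0 w y" for w y
      unfolding h_def by (simp add: power2_eq_square)
    have "P ((\<lambda>_. 0)(k := Suc (Suc 0))) x
        = h (Suc (Suc 0)) (om k) (x $ k) * (\<Prod>m\<in>UNIV - {k}. h 0 (om m) (x $ m))"
      unfolding P_def by (subst prod.remove[of _ k]) (auto intro!: prod.cong)
    also have "\<dots> = - (om k)\<^sup>2 * (h 0 (om k) (x $ k) * (\<Prod>m\<in>UNIV - {k}. h 0 (om m) (x $ m)))"
      unfolding h2 by simp
    also have "h 0 (om k) (x $ k) * (\<Prod>m\<in>UNIV - {k}. h 0 (om m) (x $ m)) = P (\<lambda>_. 0) x"
      unfolding P_def by (subst (2) prod.remove[of _ k]) auto
    finally show ?thesis .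
  qed
  let ?e = "\<lambda>k. (\<lambda>_. 0)(k := Suc 0)"
  let ?e2 = "\<lambda>k l. (?e k)(l := Suc (?e k l))"
  show ?thesis
    unfolding schroedinger_solution_def
  proof (intro exI[of _ "\<lambda>t x. (- \<i> * of_real (freq_sq j lam)) * A t * of_real (P (\<lambda>_. 0) x)"]
      exI[of _ "\<lambda>k t x. A t * of_real (P (?e k) x)"]
      exI[of _ "\<lambda>k l t x. A t * of_real (P (?e2 k l) x)"] conjI allI)
    fix t x k l
    show "((\<lambda>s. linear_wave a j lam s x) has_vector_derivative
        - \<i> * of_real (freq_sq j lam) * A t * of_real (P (\<lambda>_. 0) x)) (at t)"
      unfolding lw by (intro has_vector_derivative_mult_left At)
    show "((\<lambda>s. linear_wave a j lam t (x + s *\<^sub>R axis k 1)) has_vector_derivative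
        A t * of_real (P (?e k) x)) (at 0)"
      unfolding lw using APd[of t "\<lambda>_. 0"] by simp
    show "((\<lambda>s. A t * of_real (P (?e k) (x + s *\<^sub>R axis l 1))) has_vector_derivative
        A t * of_real (P (?e2 k l) x)) (at 0)"
      by (rule APd)
    show "continuous_on UNIV (\<lambda>(t, x). linear_wave a j lam t x)"
      unfolding lw using cont[of 1] by simp
    show "continuous_on UNIV
        (\<lambda>(t, x). - \<i> * of_real (freq_sq j lam) * A t * of_real (P (\<lambda>_. 0) x))"
      by (rule cont)
    show "continuous_on UNIV (\<lambda>(t, x). A t * of_real (P (?e k) x))"
      using cont[of 1] by simp
    show "continuous_on UNIV (\<lambda>(t, x). A t * of_real (P (?e2 k l) x))"
      using cont[of 1] by simp
    have "(\<Sum>k\<in>UNIV. A t * of_real (P (?e2 k k) x))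
        = - of_real (freq_sq j lam) * A t * of_real (P (\<lambda>_. 0) x)"
      by (simp add: P2 freq_sq_def om_def sum_distrib_right sum_distrib_left sum_negf mult_ac)
    then show "\<i> * (- \<i> * of_real (freq_sq j lam) * A t * of_real (P (\<lambda>_. 0) x)) =
        - (\<Sum>k\<in>UNIV. A t * of_real (P (?e2 k k) x)) - 0"
      by (simp add: mult.assoc[symmetric])
  qed
qed

end

theory Submission
  imports Defs
begin

text \<open>
  The solution is sought among the modes \<open>j\<close> whose blocks are odd multiples, \<open>j_k = n_k jt_k\<close> with
  \<open>n_k\<close> odd. These modes are preserved by the odd nonlinearity, and on them the linear operator has
  no small divisors: with \<open>\<omega>_k = jt_k \<cdot> \<lambda>_k\<close> the difference of the eigenvalues at \<open>j\<close> and \<open>jt\<close> is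
  the sum of \<open>(n_k^2 - 1) \<omega>_k^2\<close>, which is at least \<open>8 \<delta>^2\<close> off the sign orbit of \<open>jt\<close> as soon as
  \<open>\<bar>\<omega>_k\<bar> \<ge> \<delta>\<close> for all blocks with \<open>jt_k \<noteq> 0\<close> (lemma \<open>freq_sq_gap\<close>). With \<open>\<delta>\<close> proportional to
  \<open>\<bar>a\<bar>^(p/6)\<close>, the parameters violating this condition lie in finitely many strips of total measure
  at most \<open>\<bar>a\<bar>^(p/6)\<close> (lemma \<open>measure_nonresonant_params\<close>). The nonlinear term has size
  \<open>\<bar>a\<bar>^(2p)\<close> relative to the linear wave and the divisors are at least of order \<open>\<bar>a\<bar>^(p/3)\<close>, so a
  contraction argument suffices.

  The coefficients live in the Banach algebra \<open>\<ell>^1\<close> of the lattice under convolution, where the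
  nonlinearity is a power and evaluation at a point is a ring homomorphism. Inverting the linear
  operator gains two derivatives, so the resulting series is a classical solution
  (lemma \<open>standing_wave_solution\<close>).

  The eigenvalue is prescribed instead of the amplitude: \<open>E(\<lambda>) = (jt \<cdot> \<lambda>)^2 - c \<bar>a\<bar>^(2p)\<close>, where
  the constant \<open>c\<close> comes from projecting the power of the cosine mode on that mode. Then \<open>E\<close> is a
  polynomial in \<open>\<lambda>\<close> on the whole cube. By homogeneity of the nonlinearity the equation on the sign
  orbit can always be met by adjusting the amplitude (lemmas \<open>normalized_power_fixpoint\<close> and
  \<open>odd_lattice_profile\<close>), and the adjusted amplitude differs from \<open>a\<close> by \<open>O(\<bar>a\<bar>^(p + 1))\<close>.
\<close>

(* abs_summable_on refers to unconditional summation over a set throughout, not to its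
   measure-theoretic variant. *)
no_notation Infinite_Set_Sum.abs_summable_on (infix "abs'_summable'_on" 50)

section \<open>Absolutely summable families under convolution\<close>

lemma abs_summable_real_iff: "(\<lambda>j. \<bar>f j\<bar>) summable_on A \<longleftrightarrow> f summable_on A" for f :: "'a \<Rightarrow> real"
  using summable_on_iff_abs_summable_on_real[of f A] by (simp only: real_norm_def)

text \<open>
  For real families, unconditional summability is the same as absolute summability.
\<close>
typedef 'a l1 = "{f :: 'a \<Rightarrow> real. f summable_on UNIV}"
  morphisms coef Abs_l1
  by (rule exI[of _ "\<lambda>_. 0"]) simp

setup_lifting type_definition_l1

lemma l1_eqI: "(\<And>j. coef f j = coef g j) \<Longrightarrow> f = g"
  by transfer auto

lemma coef_summable: "coef f summable_on A"
proof -
  have "coef f summable_on UNIV" using coef[of f] by simp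
  then show ?thesis by (rule summable_on_subset_banach) simp
qed

lemma coef_abs_summable: "(\<lambda>j. \<bar>coef f j\<bar>) summable_on UNIV"
  by (simp only: abs_summable_real_iff coef_summable)

instantiation l1 :: (type) real_normed_vector
begin

lift_definition zero_l1 :: "'a l1" is "\<lambda>_. 0" by simp

lift_definition plus_l1 :: "'a l1 \<Rightarrow> 'a l1 \<Rightarrow> 'a l1" is "\<lambda>f g j. f j + g j"
  by (rule summable_on_add)

lift_definition uminus_l1 :: "'a l1 \<Rightarrow> 'a l1" is "\<lambda>f j. - f j"
  by (simp add: summable_on_uminus)

lift_definition minus_l1 :: "'a l1 \<Rightarrow> 'a l1 \<Rightarrow> 'a l1" is "\<lambda>f g j. f j - g j"
  unfolding diff_conv_add_uminus by (rule summable_on_add) (simp_all add: summable_on_uminus)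

lift_definition scaleR_l1 :: "real \<Rightarrow> 'a l1 \<Rightarrow> 'a l1" is "\<lambda>c f j. c * f j"
  by (rule summable_on_cmult_right)

definition norm_l1 :: "'a l1 \<Rightarrow> real" where
  "norm_l1 f = (\<Sum>\<^sub>\<infinity>j. \<bar>coef f j\<bar>)"

definition dist_l1 :: "'a l1 \<Rightarrow> 'a l1 \<Rightarrow> real" where
  "dist_l1 f g = norm (f - g)"

definition sgn_l1 :: "'a l1 \<Rightarrow> 'a l1" where
  "sgn_l1 f = inverse (norm f) *\<^sub>R f"

definition uniformity_l1 :: "('a l1 \<times> 'a l1) filter" where
  "uniformity_l1 = (INF e\<in>{0<..}. principal {(x, y). dist x y < e})"

definition open_l1 :: "'a l1 set \<Rightarrow> bool" where
  "open_l1 U = (\<forall>x\<in>U. eventually (\<lambda>(x', y). x' = x \<longrightarrow> y \<in> U) uniformity)"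

instance
proof
  fix f g h :: "'a l1" and a b :: real and U :: "'a l1 set"
  show "f + g + h = f + (g + h)" "f + g = g + f" "0 + f = f" "- f + f = 0" "f - g = f + - g"
    by (transfer, simp add: algebra_simps)+
  show "a *\<^sub>R (f + g) = a *\<^sub>R f + a *\<^sub>R g" "(a + b) *\<^sub>R f = a *\<^sub>R f + b *\<^sub>R f"
    "a *\<^sub>R b *\<^sub>R f = (a * b) *\<^sub>R f" "1 *\<^sub>R f = f"
    by (transfer, simp add: algebra_simps)+
  show "dist f g = norm (f - g)" "sgn f = inverse (norm f) *\<^sub>R f"
    "uniformity = (INF e\<in>{0<..}. principal {(x, y :: 'a l1). dist x y < e})"
    "open U = (\<forall>x\<in>U. \<forall>\<^sub>F (x', y) in uniformity. x' = x \<longrightarrow> y \<in> U)"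
    by (simp_all add: dist_l1_def sgn_l1_def uniformity_l1_def open_l1_def)
  show "norm f = 0 \<longleftrightarrow> f = 0"
  proof
    assume "norm f = 0"
    then have "\<bar>coef f j\<bar> = 0" for j
      using nonneg_infsum_le_0D[of "\<lambda>j. \<bar>coef f j\<bar>" UNIV] coef_abs_summable[of f]
      by (auto simp: norm_l1_def)
    then show "f = 0" by (intro l1_eqI) (simp add: zero_l1.rep_eq)
  qed (simp add: norm_l1_def zero_l1.rep_eq)
  have "norm (f + g) \<le> (\<Sum>\<^sub>\<infinity>j. \<bar>coef f j\<bar> + \<bar>coef g j\<bar>)"
    unfolding norm_l1_def
    by (intro infsum_mono coef_abs_summable summable_on_add) (auto simp: plus_l1.rep_eq)
  also have "\<dots> = norm f + norm g"
    unfolding norm_l1_def by (intro infsum_add coef_abs_summable)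
  finally show "norm (f + g) \<le> norm f + norm g" .
  show "norm (a *\<^sub>R f) = \<bar>a\<bar> * norm f"
    by (simp add: norm_l1_def scaleR_l1.rep_eq abs_mult infsum_cmult_right')
qed

end

lemmas coef_simps = zero_l1.rep_eq plus_l1.rep_eq uminus_l1.rep_eq minus_l1.rep_eq
  scaleR_l1.rep_eq

lemma sum_coef_le_norm: "finite F \<Longrightarrow> (\<Sum>j\<in>F. \<bar>coef f j\<bar>) \<le> norm f"
  unfolding norm_l1_def by (rule finite_sum_le_infsum) (auto intro: coef_abs_summable)

lemma abs_coef_le_norm: "\<bar>coef f j\<bar> \<le> norm f"
  using sum_coef_le_norm[of "{j}" f] by simp

lemma norm_l1_le:
  assumes "\<And>F. finite F \<Longrightarrow> (\<Sum>j\<in>F. \<bar>coef f j\<bar>) \<le> B"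
  shows "norm f \<le> B"
  unfolding norm_l1_def
  by (rule infsum_le_finite_sums) (use assms coef_abs_summable in auto)

lemma bounded_linear_coef: "bounded_linear (\<lambda>f. coef f j)"
  by (rule bounded_linear_intro[of _ 1]) (auto simp: coef_simps abs_coef_le_norm)

text \<open>
  A Cauchy sequence converges coefficientwise; the Cauchy estimate for finite partial sums survives
  the passage to the coefficientwise limit, which makes the limit summable and the convergence
  one in norm.
\<close>
instance l1 :: (type) banach
proof
  fix X :: "nat \<Rightarrow> 'a l1"
  assume X: "Cauchy X"
  have "\<exists>l. (\<lambda>n. coef (X n) j) \<longlonglongrightarrow> l" for j
    using Cauchy_convergent[OF bounded_linear.Cauchy[OF bounded_linear_coef X]]
    by (auto simp: convergent_def)
  then obtain l where l: "(\<lambda>n. coef (X n) j) \<longlonglongrightarrow> l j" for j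
    by metis
  have ev: "\<exists>N. \<forall>n\<ge>N. \<forall>F. finite F \<longrightarrow> (\<Sum>j\<in>F. \<bar>l j - coef (X n) j\<bar>) \<le> e" if "e > 0" for e
  proof -
    obtain N where N: "\<And>m n. m \<ge> N \<Longrightarrow> n \<ge> N \<Longrightarrow> norm (X m - X n) < e"
      using CauchyD[OF X \<open>e > 0\<close>] by blast
    have "(\<Sum>j\<in>F. \<bar>l j - coef (X n) j\<bar>) \<le> e" if "n \<ge> N" "finite F" for n F
    proof (rule tendsto_upperbound)
      show "(\<lambda>m. \<Sum>j\<in>F. \<bar>coef (X m) j - coef (X n) j\<bar>) \<longlonglongrightarrow> (\<Sum>j\<in>F. \<bar>l j - coef (X n) j\<bar>)"
        by (intro tendsto_intros l)
      show "\<forall>\<^sub>F m in sequentially. (\<Sum>j\<in>F. \<bar>coef (X m) j - coef (X n) j\<bar>) \<le> e"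
        using eventually_ge_at_top[of N]
      proof eventually_elim
        case (elim m)
        then show ?case
          using sum_coef_le_norm[OF \<open>finite F\<close>, of "X m - X n"] N[OF elim \<open>n \<ge> N\<close>]
          by (simp add: coef_simps)
      qed
    qed simp
    then show ?thesis by blast
  qed
  obtain N where N: "\<And>F. finite F \<Longrightarrow> (\<Sum>j\<in>F. \<bar>l j - coef (X N) j\<bar>) \<le> 1"
    using ev[of 1] by auto
  have "(\<lambda>j. l j - coef (X N) j) abs_summable_on UNIV"
    unfolding abs_summable_iff_bdd_above by (rule bdd_aboveI2[of _ _ 1]) (use N in auto)
  then have "(\<lambda>j. (l j - coef (X N) j) + coef (X N) j) summable_on UNIV"
    by (rule summable_on_add[OF abs_summable_summable coef_summable])
  then have cl: "coef (Abs_l1 l) = l"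
    by (intro Abs_l1_inverse) simp
  have lim: "\<exists>N. \<forall>n\<ge>N. norm (X n - Abs_l1 l) \<le> e" if "e > 0" for e
  proof -
    have "norm (Abs_l1 l - X n) \<le> e" if "\<forall>F. finite F \<longrightarrow> (\<Sum>j\<in>F. \<bar>l j - coef (X n) j\<bar>) \<le> e" for n
      by (rule norm_l1_le) (use that cl in \<open>simp add: coef_simps\<close>)
    then show ?thesis
      using ev[OF that] by (metis norm_minus_commute)
  qed
  have "X \<longlonglongrightarrow> Abs_l1 l"
  proof (rule metric_LIMSEQ_I)
    fix r :: real assume "r > 0"
    then obtain N where "\<forall>n\<ge>N. norm (X n - Abs_l1 l) \<le> r / 2" using lim[of "r/2"] by auto
    then show "\<exists>N. \<forall>n\<ge>N. dist (X n) (Abs_l1 l) < r"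
      using \<open>r > 0\<close> by (intro exI[of _ N]) (force simp: dist_norm)
  qed
  then show "convergent X" by (auto simp: convergent_def)
qed

text \<open>
  The substitution \<open>n - m\<close> for fixed \<open>m\<close> turns the double family into a product family, so that
  Fubini applies. Part 2 yields the submultiplicative norm; part 3, applied to coefficients
  multiplied by a character, makes evaluation at that character multiplicative.
\<close>
lemma convolution_abs_summable:
  fixes f g :: "'a::ab_group_add \<Rightarrow> 'b::{real_normed_div_algebra,banach}"
  assumes f: "f abs_summable_on UNIV" and g: "g abs_summable_on UNIV"
  shows "(\<lambda>(m, n). f m * g (n - m)) abs_summable_on UNIV \<times> UNIV"
    and "(\<Sum>\<^sub>\<infinity>n. \<Sum>\<^sub>\<infinity>m. norm (f m * g (n - m))) = (\<Sum>\<^sub>\<infinity>m. norm (f m)) * (\<Sum>\<^sub>\<infinity>n. norm (g n))"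
    and "(\<Sum>\<^sub>\<infinity>n. \<Sum>\<^sub>\<infinity>m. f m * g (n - m)) = (\<Sum>\<^sub>\<infinity>m. f m) * (\<Sum>\<^sub>\<infinity>n. g n)"
proof -
  have bij: "bij_betw (\<lambda>n. n - m) UNIV UNIV" for m :: 'a
    by (rule bij_betwI[of _ _ _ "\<lambda>n. n + m"]) auto
  have shift: "(\<lambda>n. norm (g (n - m))) summable_on UNIV" for m
    using g summable_on_reindex_bij_betw[OF bij, of "\<lambda>n. norm (g n)" m] by simp
  have shiftn: "(\<Sum>\<^sub>\<infinity>n. norm (g (n - m))) = (\<Sum>\<^sub>\<infinity>n. norm (g n))" for m
    by (rule infsum_reindex_bij_betw[OF bij])
  have shifts: "(\<Sum>\<^sub>\<infinity>n. g (n - m)) = (\<Sum>\<^sub>\<infinity>n. g n)" for m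
    by (rule infsum_reindex_bij_betw[OF bij])
  show *: "(\<lambda>(m, n). f m * g (n - m)) abs_summable_on UNIV \<times> UNIV"
    unfolding Infinite_Sum.abs_summable_on_Sigma_iff
    by (auto simp: norm_mult infsum_cmult_right' shiftn abs_mult
        intro!: summable_on_cmult_right summable_on_cmult_left shift f)
  have "(\<Sum>\<^sub>\<infinity>n. \<Sum>\<^sub>\<infinity>m. norm (f m * g (n - m))) = (\<Sum>\<^sub>\<infinity>m. \<Sum>\<^sub>\<infinity>n. norm (f m * g (n - m)))"
    using * by (intro infsum_swap_banach[symmetric]) (simp add: case_prod_unfold)
  then show "(\<Sum>\<^sub>\<infinity>n. \<Sum>\<^sub>\<infinity>m. norm (f m * g (n - m))) = (\<Sum>\<^sub>\<infinity>m. norm (f m)) * (\<Sum>\<^sub>\<infinity>n. norm (g n))"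
    by (simp add: norm_mult infsum_cmult_right' infsum_cmult_left' shiftn)
  have "(\<Sum>\<^sub>\<infinity>n. \<Sum>\<^sub>\<infinity>m. f m * g (n - m)) = (\<Sum>\<^sub>\<infinity>m. \<Sum>\<^sub>\<infinity>n. f m * g (n - m))"
    using abs_summable_summable[OF *]
    by (intro infsum_swap_banach[symmetric]) (simp add: case_prod_unfold)
  then show "(\<Sum>\<^sub>\<infinity>n. \<Sum>\<^sub>\<infinity>m. f m * g (n - m)) = (\<Sum>\<^sub>\<infinity>m. f m) * (\<Sum>\<^sub>\<infinity>n. g n)"
    by (simp add: infsum_cmult_right' infsum_cmult_left' shifts)
qed

lemma reflect_infsum:
  fixes h :: "'a::ab_group_add \<Rightarrow> 'b::banach"
  shows "(\<Sum>\<^sub>\<infinity>m. h (n - m)) = (\<Sum>\<^sub>\<infinity>m. h m)"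
  by (rule infsum_reindex_bij_betw, rule bij_betwI[of _ _ _ "\<lambda>m. n - m"]) auto

instantiation l1 :: (ab_group_add) "{comm_ring_1, real_normed_algebra_1}"
begin

lift_definition one_l1 :: "'a l1" is "\<lambda>j. if j = 0 then 1 else 0"
  by (rule finite_nonzero_values_imp_summable_on) simp

lift_definition times_l1 :: "'a l1 \<Rightarrow> 'a l1 \<Rightarrow> 'a l1" is "\<lambda>f g n. \<Sum>\<^sub>\<infinity>m. f m * g (n - m)"
proof -
  fix f g :: "'a \<Rightarrow> real"
  assume "f summable_on UNIV" "g summable_on UNIV"
  then have "f abs_summable_on UNIV" "g abs_summable_on UNIV"
    by (simp_all add: abs_summable_real_iff)
  note * = convolution_abs_summable(1)[OF this]
  have "(\<lambda>(n, m). f m * g (n - m)) summable_on UNIV \<times> UNIV"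
    using summable_on_swap[THEN iffD1, OF abs_summable_summable[OF *]] by (simp add: case_prod_unfold prod.swap_def)
  then show "(\<lambda>n. \<Sum>\<^sub>\<infinity>m. f m * g (n - m)) summable_on UNIV"
    using summable_on_Sigma_banach[of "\<lambda>n m. f m * g (n - m)" UNIV "\<lambda>_. UNIV"] by simp
qed

lemma convolution_summable: "(\<lambda>m. coef f m * coef g (n - m)) summable_on A"
proof -
  have "(\<lambda>m. norm (coef f m * coef g (n - m))) summable_on UNIV"
    by (rule Infinite_Sum.abs_summable_on_comparison_test'[where g = "\<lambda>m. \<bar>coef f m\<bar> * norm g"])
      (auto simp: abs_mult intro!: mult_left_mono abs_coef_le_norm summable_on_cmult_left coef_abs_summable)
  from summable_on_subset_banach[OF abs_summable_summable[OF this]] show ?thesis by simp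
qed

text \<open>
  Associativity and commutativity together amount to this interchange of two sums; it is legitimate
  because the coefficients of \<open>g\<close> are bounded.
\<close>
lemma mult_assoc_coef:
  fixes f g h :: "'a l1"
  shows "(\<Sum>\<^sub>\<infinity>b. (\<Sum>\<^sub>\<infinity>a. coef f a * coef g (n - b - a)) * coef h b)
       = (\<Sum>\<^sub>\<infinity>a. coef f a * (\<Sum>\<^sub>\<infinity>b. coef h b * coef g (n - a - b)))"
proof -
  have "(\<lambda>(b, a). \<bar>coef h b\<bar> * \<bar>coef f a\<bar>) abs_summable_on UNIV \<times> UNIV"
    unfolding Infinite_Sum.abs_summable_on_Sigma_iff
    by (auto simp: abs_mult infsum_cmult_right' intro!: summable_on_cmult_right summable_on_cmult_left coef_abs_summable)
  then have "(\<lambda>x. norm g * norm (case x of (b, a) \<Rightarrow> \<bar>coef h b\<bar> * \<bar>coef f a\<bar>)) summable_on UNIV \<times> UNIV"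
    by (rule summable_on_cmult_right)
  then have "(\<lambda>(b, a). coef f a * coef h b * coef g (n - a - b)) abs_summable_on UNIV \<times> UNIV"
  proof (rule Infinite_Sum.abs_summable_on_comparison_test')
    fix x :: "'a \<times> 'a"
    obtain b a where x: "x = (b, a)" by force
    show "norm (case x of (b, a) \<Rightarrow> coef f a * coef h b * coef g (n - a - b))
        \<le> norm g * norm (case x of (b, a) \<Rightarrow> \<bar>coef h b\<bar> * \<bar>coef f a\<bar>)"
      using mult_right_mono[OF abs_coef_le_norm[of g "n - a - b"], of "\<bar>coef h b\<bar> * \<bar>coef f a\<bar>"]
      by (simp add: x abs_mult mult_ac)
  qed
  note swap = infsum_swap_banach[OF abs_summable_summable[OF this]]
  have "(\<Sum>\<^sub>\<infinity>a. coef f a * coef g (n - b - a)) * coef h b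
      = (\<Sum>\<^sub>\<infinity>a. coef f a * coef h b * coef g (n - a - b))" for b
    by (subst infsum_cmult_left'[symmetric]) (simp add: mult_ac cancel_ab_semigroup_add_class.diff_right_commute[of n b])
  moreover have "coef f a * (\<Sum>\<^sub>\<infinity>b. coef h b * coef g (n - a - b))
      = (\<Sum>\<^sub>\<infinity>b. coef f a * coef h b * coef g (n - a - b))" for a
    by (subst infsum_cmult_right'[symmetric]) (simp add: mult_ac)
  ultimately show ?thesis
    using swap by simp
qed

instance
proof
  fix f g h :: "'a l1" and a :: real
  have comm: "f * g = g * f" for f g :: "'a l1"
  proof (rule l1_eqI)
    fix n
    show "coef (f * g) n = coef (g * f) n"
      using reflect_infsum[of "\<lambda>m. coef f m * coef g (n - m)" n]
      by (simp add: times_l1.rep_eq mult.commute)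
  qed
  then show "f * g = g * f" .
  show "f * g * h = f * (g * h)"
  proof (rule l1_eqI)
    fix n
    have "coef (f * g * h) n = (\<Sum>\<^sub>\<infinity>b. (\<Sum>\<^sub>\<infinity>a. coef f a * coef g (n - b - a)) * coef h b)"
      using reflect_infsum[of "\<lambda>m. coef (f * g) m * coef h (n - m)" n]
      by (simp add: times_l1.rep_eq)
    also have "\<dots> = coef (f * (h * g)) n"
      unfolding mult_assoc_coef by (simp add: times_l1.rep_eq)
    finally show "coef (f * g * h) n = coef (f * (g * h)) n" by (simp add: comm)
  qed
  show one: "1 * f = f" for f :: "'a l1"
  proof (rule l1_eqI)
    fix n
    have "coef (1 * f) n = (\<Sum>\<^sub>\<infinity>m\<in>{0::'a}. coef f n)"
      unfolding times_l1.rep_eq by (intro infsum_cong_neutral) (auto simp: one_l1.rep_eq)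
    then show "coef (1 * f) n = coef f n" by simp
  qed
  show "f * 1 = f"
    by (simp add: comm[of f] one)
  show distr: "(f + g) * h = f * h + g * h" for f g h :: "'a l1"
    by (rule l1_eqI)
      (simp add: times_l1.rep_eq coef_simps distrib_right infsum_add convolution_summable)
  show "f * (g + h) = f * g + f * h"
    using distr[of g h f] by (simp add: comm)
  show sc: "a *\<^sub>R f * g = a *\<^sub>R (f * g)" for f g :: "'a l1"
    by (rule l1_eqI) (simp add: times_l1.rep_eq coef_simps mult.assoc infsum_cmult_right')
  show "f * a *\<^sub>R g = a *\<^sub>R (f * g)"
    using sc[of g f] by (simp add: comm)
  have "coef (0::'a l1) 0 \<noteq> coef 1 0" by (simp add: one_l1.rep_eq coef_simps)
  then show "(0::'a l1) \<noteq> 1" by metis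
  have "norm (1::'a l1) = (\<Sum>\<^sub>\<infinity>j\<in>{0::'a}. 1)"
    unfolding norm_l1_def by (rule infsum_cong_neutral) (auto simp: one_l1.rep_eq)
  then show "norm (1::'a l1) = 1" by simp
  note c = convolution_abs_summable[of "coef f" "coef g"]
  have fg: "coef f abs_summable_on UNIV" "coef g abs_summable_on UNIV"
    using coef_abs_summable by auto
  have "(\<lambda>(n, m). norm (coef f m * coef g (n - m))) summable_on UNIV \<times> UNIV"
    using summable_on_swap[THEN iffD1, OF c(1)[OF fg]] by (simp add: case_prod_unfold prod.swap_def)
  then have s: "(\<lambda>n. \<Sum>\<^sub>\<infinity>m. norm (coef f m * coef g (n - m))) summable_on UNIV"
    using summable_on_Sigma_banach[of "\<lambda>n m. norm (coef f m * coef g (n - m))" UNIV "\<lambda>_. UNIV"] by simp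
  have "norm (f * g) \<le> (\<Sum>\<^sub>\<infinity>n. \<Sum>\<^sub>\<infinity>m. norm (coef f m * coef g (n - m)))"
    unfolding norm_l1_def
  proof (rule infsum_mono[OF coef_abs_summable s])
    fix n
    have "(\<lambda>m. coef f m * coef g (n - m)) abs_summable_on UNIV"
      by (simp add: abs_summable_real_iff convolution_summable flip: abs_mult)
    from norm_infsum_bound[OF this]
    show "\<bar>coef (f * g) n\<bar> \<le> (\<Sum>\<^sub>\<infinity>m. norm (coef f m * coef g (n - m)))"
      by (simp add: times_l1.rep_eq)
  qed
  also have "\<dots> = norm f * norm g"
    using c(2)[OF fg] by (simp add: norm_l1_def)
  finally show "norm (f * g) \<le> norm f * norm g" .
qed

end

section \<open>Supports, symmetries and positivity of powers\<close>

lemma coef_mult_support: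
  assumes "coef (f * g) n \<noteq> 0"
  shows "\<exists>m. coef f m \<noteq> 0 \<and> coef g (n - m) \<noteq> 0"
proof (rule ccontr)
  assume "\<not> ?thesis"
  then have "coef f m * coef g (n - m) = 0" for m by auto
  then have "coef (f * g) n = 0" by (simp only: times_l1.rep_eq infsum_0_simp)
  then show False using assms by simp
qed

text \<open>
  For a family \<open>P\<close> of index sets that is graded under addition, the support of a power stays in the
  set of matching degree. This is how the parity of the mode orders is preserved by the nonlinearity.
\<close>
lemma coef_power_support:
  assumes "\<And>j. coef f j \<noteq> 0 \<Longrightarrow> j \<in> P 1" and "0 \<in> P 0"
    and "\<And>m n i j. i \<in> P m \<Longrightarrow> j \<in> P n \<Longrightarrow> i + j \<in> P (m + n)"
  shows "coef (f ^ n) j \<noteq> 0 \<Longrightarrow> j \<in> P n"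
proof (induction n arbitrary: j)
  case (Suc n)
  then obtain m where "coef f m \<noteq> 0" "coef (f ^ n) (j - m) \<noteq> 0"
    using coef_mult_support by (metis power_Suc)
  then show ?case using assms(1)[of m] assms(3)[of m 1 "j - m" n] Suc.IH by simp
qed (use assms in \<open>auto simp: one_l1.rep_eq split: if_splits\<close>)

lemma coef_power_invariant:
  fixes T :: "'a::ab_group_add \<Rightarrow> 'a"
  assumes T: "\<And>i j. T (i + j) = T i + T j" "\<And>j. T (T j) = j"
    and f: "\<And>j. coef f (T j) = coef f j"
  shows "coef (f ^ n) (T j) = coef (f ^ n) j"
proof (induction n arbitrary: j)
  case 0
  have "T 0 = 0" using T(1)[of 0 0] by simp
  then have "T j = 0 \<longleftrightarrow> j = 0" using T(2) by metis
  then show ?case by (simp add: one_l1.rep_eq)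
next
  case (Suc n)
  have diff: "T (i - j) = T i - T j" for i j
    using T(1)[of "i - j" j] by (simp add: algebra_simps)
  have bij: "bij_betw T UNIV UNIV" by (rule bij_betwI[of _ _ _ T]) (auto simp: T)
  have "coef (f * f ^ n) (T j) = (\<Sum>\<^sub>\<infinity>m. coef f (T m) * coef (f ^ n) (T j - T m))"
    unfolding times_l1.rep_eq by (rule infsum_reindex_bij_betw[OF bij, symmetric])
  also have "\<dots> = coef (f * f ^ n) j"
    by (simp add: times_l1.rep_eq f Suc flip: diff)
  finally show ?case by simp
qed

lemma coef_mult_ge:
  assumes "\<And>j. coef f j \<ge> 0" "\<And>j. coef g j \<ge> 0"
  shows "coef (f * g) (m + n) \<ge> coef f m * coef g n"
  using finite_sum_le_infsum[OF convolution_summable[of f g "m + n" UNIV], of "{m}"] assms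
  by (simp add: times_l1.rep_eq)

lemma coef_mult_nonneg:
  assumes "\<And>j. coef f j \<ge> 0" "\<And>j. coef g j \<ge> 0"
  shows "coef (f * g) j \<ge> 0"
  using assms by (simp add: times_l1.rep_eq infsum_nonneg)

lemma coef_power_nonneg: "(\<And>j. coef f j \<ge> 0) \<Longrightarrow> coef (f ^ n) j \<ge> 0"
  by (induction n arbitrary: j) (auto simp: one_l1.rep_eq intro: coef_mult_nonneg)

text \<open>
  Among the terms of the convolution at \<open>j\<close> there is the one that adds \<open>j\<close> and \<open>- j\<close> alternately;
  nothing can cancel it when all coefficients are nonnegative.
\<close>
lemma coef_odd_power_pos:
  assumes "\<And>j. coef f j \<ge> 0" "coef f j > 0" "coef f (- j) > 0"
  shows "coef (f ^ (2 * p + 1)) j > 0"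
proof (induction p)
  case (Suc p)
  have "0 < coef f j * (coef f (- j) * coef (f ^ (2 * p + 1)) j)"
    using Suc assms by simp
  also have "\<dots> \<le> coef f j * coef (f * f ^ (2 * p + 1)) (- j + j)"
    by (intro mult_left_mono coef_mult_ge coef_power_nonneg assms)
  also have "\<dots> \<le> coef (f * (f * f ^ (2 * p + 1))) (j + (- j + j))"
    by (intro coef_mult_ge coef_mult_nonneg coef_power_nonneg assms)
  finally show ?case by simp
qed (use assms in simp)

section \<open>Fourier multipliers and evaluation at characters\<close>

text \<open>
  The Fourier multiplier with symbol \<open>m\<close>. The definition is meaningful when the product is summable,
  in particular for bounded \<open>m\<close>.
\<close>
definition l1_multiplier :: "('a \<Rightarrow> real) \<Rightarrow> 'a l1 \<Rightarrow> 'a l1" where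
  "l1_multiplier m f = Abs_l1 (\<lambda>j. m j * coef f j)"

lemma
  assumes "\<And>j. \<bar>m j\<bar> \<le> \<kappa>"
  shows coef_multiplier: "coef (l1_multiplier m f) j = m j * coef f j"
    and norm_multiplier_le: "norm (l1_multiplier m f) \<le> \<kappa> * norm f"
    and linear_multiplier: "linear (l1_multiplier m)"
proof -
  have le: "\<bar>m j * coef f j\<bar> \<le> \<kappa> * \<bar>coef f j\<bar>" for j f
    using assms by (simp add: abs_mult mult_right_mono)
  have s: "(\<lambda>j. \<kappa> * \<bar>coef f j\<bar>) summable_on UNIV" for f :: "'a l1"
    by (intro summable_on_cmult_right coef_abs_summable)
  have "(\<lambda>j. m j * coef f j) summable_on UNIV" for f
  proof -
    have "(\<lambda>j. norm (m j * coef f j)) summable_on UNIV"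
      by (rule Infinite_Sum.abs_summable_on_comparison_test'[OF s[of f]]) (simp only: real_norm_def le)
    then show ?thesis by (simp only: real_norm_def abs_summable_real_iff)
  qed
  then have c: "coef (l1_multiplier m f) = (\<lambda>j. m j * coef f j)" for f
    unfolding l1_multiplier_def by (intro Abs_l1_inverse) simp
  show "coef (l1_multiplier m f) j = m j * coef f j"
    by (simp add: c)
  have "norm (l1_multiplier m f) \<le> (\<Sum>\<^sub>\<infinity>j. \<kappa> * \<bar>coef f j\<bar>)"
    unfolding norm_l1_def by (rule infsum_mono[OF coef_abs_summable s]) (simp only: c le)
  then show "norm (l1_multiplier m f) \<le> \<kappa> * norm f"
    by (simp add: norm_l1_def infsum_cmult_right')
  show "linear (l1_multiplier m)"
    by (rule linearI; rule l1_eqI) (simp_all add: c coef_simps algebra_simps)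
qed

text \<open>
  The value of the Fourier series with coefficients \<open>f\<close>, where \<open>\<psi> j\<close> is the value of the
  \<open>j\<close>-th exponential.
\<close>
definition l1_eval :: "('a \<Rightarrow> complex) \<Rightarrow> 'a l1 \<Rightarrow> complex" where
  "l1_eval \<psi> f = (\<Sum>\<^sub>\<infinity>j. of_real (coef f j) * \<psi> j)"

context
  fixes \<psi> :: "'a::ab_group_add \<Rightarrow> complex"
  assumes \<psi>_add: "\<And>i j. \<psi> (i + j) = \<psi> i * \<psi> j" and \<psi>_norm: "\<And>j. norm (\<psi> j) = 1"
begin

lemma l1_eval_summable: "(\<lambda>j. of_real (coef f j) * \<psi> j) summable_on UNIV"
  by (rule abs_summable_summable) (simp add: norm_mult \<psi>_norm coef_abs_summable)

lemma l1_eval_has_sum: "((\<lambda>j. of_real (coef f j) * \<psi> j) has_sum l1_eval \<psi> f) UNIV"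
  unfolding l1_eval_def by (rule has_sum_infsum[OF l1_eval_summable])

lemma l1_eval_add: "l1_eval \<psi> (f + g) = l1_eval \<psi> f + l1_eval \<psi> g"
  by (simp add: l1_eval_def coef_simps distrib_right infsum_add l1_eval_summable)

lemma l1_eval_scaleR: "l1_eval \<psi> (c *\<^sub>R f) = of_real c * l1_eval \<psi> f"
  by (simp add: l1_eval_def coef_simps mult.assoc infsum_cmult_right')

lemma l1_eval_mult: "l1_eval \<psi> (f * g) = l1_eval \<psi> f * l1_eval \<psi> g"
proof -
  define F where "F f j = of_real (coef f j) * \<psi> j" for f j
  have F: "F f abs_summable_on UNIV" for f
    using coef_abs_summable[of f] by (simp add: F_def norm_mult \<psi>_norm)
  have "of_real (coef (f * g) n) * \<psi> n = (\<Sum>\<^sub>\<infinity>m. F f m * F g (n - m))" for n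
  proof -
    have "((\<lambda>m. coef f m * coef g (n - m)) has_sum coef (f * g) n) UNIV"
      by (simp add: times_l1.rep_eq convolution_summable)
    then have "((\<lambda>m. of_real (coef f m * coef g (n - m)) * \<psi> n) has_sum of_real (coef (f * g) n) * \<psi> n) UNIV"
      by (intro has_sum_cmult_left has_sum_of_real)
    moreover have "of_real (coef f m * coef g (n - m)) * \<psi> n = F f m * F g (n - m)" for m
      using \<psi>_add[of m "n - m"] by (simp add: F_def)
    ultimately show ?thesis by (simp add: infsumI)
  qed
  then have "l1_eval \<psi> (f * g) = (\<Sum>\<^sub>\<infinity>n. \<Sum>\<^sub>\<infinity>m. F f m * F g (n - m))"
    by (simp add: l1_eval_def)
  also have "\<dots> = l1_eval \<psi> f * l1_eval \<psi> g"
    unfolding convolution_abs_summable(3)[OF F F] by (simp add: l1_eval_def F_def[abs_def])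
  finally show ?thesis .
qed

lemma l1_eval_power: "l1_eval \<psi> (f ^ n) = l1_eval \<psi> f ^ n"
proof (induction n)
  case 0
  have "\<psi> 0 = 1" using \<psi>_add[of 0 0] \<psi>_norm[of 0] by auto
  then have "l1_eval \<psi> 1 = (\<Sum>\<^sub>\<infinity>j\<in>{0::'a}. 1)"
    unfolding l1_eval_def by (intro infsum_cong_neutral) (auto simp: one_l1.rep_eq)
  then show ?case by simp
qed (simp add: l1_eval_mult)

end

section \<open>A normalized fixed point equation in Banach algebras\<close>

lemma norm_power_diff_le:
  fixes x y :: "'a::real_normed_algebra_1"
  assumes "norm x \<le> R" "norm y \<le> R" "R \<ge> 1"
  shows "norm (x ^ n - y ^ n) \<le> real n * R ^ n * norm (x - y)"
proof (induction n)
  case (Suc n)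
  have "x ^ Suc n - y ^ Suc n = x * (x ^ n - y ^ n) + (x - y) * y ^ n"
    by (simp add: algebra_simps)
  also have "norm \<dots> \<le> norm x * norm (x ^ n - y ^ n) + norm (x - y) * norm (y ^ n)"
    by (rule order_trans[OF norm_triangle_ineq add_mono[OF norm_mult_ineq norm_mult_ineq]])
  also have "norm x * norm (x ^ n - y ^ n) \<le> R * (real n * R ^ n * norm (x - y))"
    using assms by (intro mult_mono Suc) auto
  also have "norm (x - y) * norm (y ^ n) \<le> norm (x - y) * R ^ Suc n"
  proof (rule mult_left_mono)
    have "norm (y ^ n) \<le> norm y ^ n" by (rule norm_power_ineq)
    also have "\<dots> \<le> R ^ n" using assms by (intro power_mono) auto
    also have "\<dots> \<le> R ^ Suc n" using assms by (intro power_increasing) auto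
    finally show "norm (y ^ n) \<le> R ^ Suc n" .
  qed simp
  finally show ?case by (simp add: algebra_simps)
qed simp

text \<open>
  The map \<open>w \<mapsto> (\<phi> + w)^n / l ((\<phi> + w)^n) - w\<close> is bounded and Lipschitz on a small ball, where the
  denominator stays away from 0. Composed with an operator of norm at most \<open>\<kappa>\<close> it becomes a
  contraction of that ball as soon as \<open>\<kappa>\<close> is small, and its fixed point has size \<open>O(\<kappa>)\<close>.

  Dividing by \<open>l\<close> is the device that removes the bifurcation equation: it normalizes the component
  of the power along \<open>\<phi>\<close>, so that only the component complementary to \<open>\<phi>\<close> has to be solved for.
  The constants depend on \<open>\<phi>\<close>, \<open>l\<close> and \<open>n\<close> alone; the closed set \<open>X\<close> serves to carry a symmetry
  over to the fixed point.
\<close>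
lemma normalized_power_fixpoint:
  fixes \<phi> :: "'a::{real_normed_algebra_1, banach}" and l :: "'a \<Rightarrow> real"
  assumes l: "bounded_linear l" and c0: "l (\<phi> ^ n) > 0"
  shows "\<exists>K>0. \<exists>\<kappa>0>0. \<forall>\<kappa> M X.
    0 \<le> \<kappa> \<longrightarrow> \<kappa> \<le> \<kappa>0 \<longrightarrow> linear M \<longrightarrow> (\<forall>f. norm (M f) \<le> \<kappa> * norm f) \<longrightarrow>
    closed X \<longrightarrow> 0 \<in> X \<longrightarrow> (\<forall>w\<in>X. M ((\<phi> + w) ^ n /\<^sub>R l ((\<phi> + w) ^ n) - w) \<in> X) \<longrightarrow>
    (\<exists>w\<in>X. w = M ((\<phi> + w) ^ n /\<^sub>R l ((\<phi> + w) ^ n) - w) \<and> norm w \<le> K * \<kappa> \<and>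
       l ((\<phi> + w) ^ n) > 0 \<and> \<bar>l ((\<phi> + w) ^ n) - l (\<phi> ^ n)\<bar> \<le> K * \<kappa>)"
proof -
  define R where "R = norm \<phi> + 1"
  define c where "c = l (\<phi> ^ n)"
  define L where "L = real n * R ^ n"
  have R: "R \<ge> 1" "R > 0" by (simp_all add: R_def add_nonneg_pos)
  have L: "L \<ge> 0" using R by (simp add: L_def)
  have c: "c > 0" using c0 by (simp add: c_def)
  obtain B where B: "B > 0" "\<And>x. \<bar>l x\<bar> \<le> B * norm x"
    using bounded_linear.pos_bounded[OF l] by (auto simp: mult.commute)
  define \<rho> where "\<rho> = min 1 (c / (2 * (B * L + 1)))"
  have BL: "B * L \<ge> 0" "B * L + 1 > 0" using B L by (simp_all add: add_nonneg_pos)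
  have \<rho>: "\<rho> > 0" "\<rho> \<le> 1" "\<rho> \<le> c / (2 * (B * L + 1))"
    using c BL by (auto simp: \<rho>_def)
  have BL\<rho>: "B * L * \<rho> \<le> c / 2"
  proof -
    have "B * L * \<rho> \<le> (B * L + 1) * (c / (2 * (B * L + 1)))"
      using BL \<rho> by (intro mult_mono) auto
    also have "\<dots> = c / 2" using BL by (simp add: field_simps)
    finally show ?thesis .
  qed
  define \<mu> where "\<mu> w = l ((\<phi> + w) ^ n)" for w
  define G where "G w = (\<phi> + w) ^ n /\<^sub>R \<mu> w - w" for w
  have bd: "norm (\<phi> + w) \<le> R" if "norm w \<le> \<rho>" for w
    using norm_triangle_ineq[of \<phi> w] that \<rho> by (simp add: R_def)
  have pw: "norm ((\<phi> + w) ^ n) \<le> R ^ n" if "norm w \<le> \<rho>" for w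
    using norm_power_ineq[of "\<phi> + w" n] power_mono[OF bd[OF that], of n] by simp
  have lip: "norm ((\<phi> + w) ^ n - (\<phi> + w') ^ n) \<le> L * norm (w - w')"
    if "norm w \<le> \<rho>" "norm w' \<le> \<rho>" for w w'
    using norm_power_diff_le[OF bd[OF that(1)] bd[OF that(2)] R(1), of n] by (simp add: L_def)
  have lip\<mu>: "\<bar>\<mu> w - \<mu> w'\<bar> \<le> B * L * norm (w - w')" if "norm w \<le> \<rho>" "norm w' \<le> \<rho>" for w w'
  proof -
    have "\<mu> w - \<mu> w' = l ((\<phi> + w) ^ n - (\<phi> + w') ^ n)"
      by (simp add: \<mu>_def linear_diff[OF bounded_linear.linear[OF l]])
    also have "\<bar>\<dots>\<bar> \<le> B * norm ((\<phi> + w) ^ n - (\<phi> + w') ^ n)" by (rule B)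
    also have "\<dots> \<le> B * (L * norm (w - w'))"
      using B lip[OF that] by (intro mult_left_mono) auto
    finally show ?thesis by (simp add: mult.assoc)
  qed
  have \<mu>0: "\<mu> 0 = c" by (simp add: \<mu>_def c_def)
  have near: "\<bar>\<mu> w - c\<bar> \<le> B * L * norm w" if "norm w \<le> \<rho>" for w
    using lip\<mu>[of w 0] that \<rho> \<mu>0 by simp
  have \<mu>: "\<mu> w \<ge> c / 2" if "norm w \<le> \<rho>" for w
  proof -
    have "B * L * norm w \<le> B * L * \<rho>" using that BL by (intro mult_left_mono)
    then show ?thesis using near[OF that] BL\<rho> by linarith
  qed
  have inv\<mu>: "\<bar>inverse (\<mu> w)\<bar> \<le> 2 / c" "\<mu> w > 0" if "norm w \<le> \<rho>" for w
    using \<mu>[OF that] c le_imp_inverse_le[OF \<mu>[OF that]] by auto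
  define K1 where "K1 = 2 / c * R ^ n + 1"
  define K2 where "K2 = 2 / c * L + (2 / c) * (2 / c) * (B * L) * R ^ n + 1"
  have K1: "K1 > 0" using c R by (auto simp: K1_def intro!: add_nonneg_pos)
  have K2: "K2 > 0" using c R BL L by (auto simp: K2_def intro!: add_nonneg_pos add_nonneg_nonneg mult_nonneg_nonneg)
  have G1: "norm (G w) \<le> K1" if w: "norm w \<le> \<rho>" for w
  proof -
    have "norm (G w) \<le> \<bar>inverse (\<mu> w)\<bar> * norm ((\<phi> + w) ^ n) + norm w"
      unfolding G_def by (rule order_trans[OF norm_triangle_ineq4]) simp
    also have "\<dots> \<le> 2 / c * R ^ n + 1"
      using inv\<mu>[OF w] pw[OF w] w \<rho> c by (intro add_mono mult_mono) auto
    finally show ?thesis by (simp add: K1_def)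
  qed
  have G2: "norm (G w - G w') \<le> K2 * norm (w - w')" if w: "norm w \<le> \<rho>" and w': "norm w' \<le> \<rho>" for w w'
  proof -
    have eq: "G w - G w' = ((\<phi> + w) ^ n - (\<phi> + w') ^ n) /\<^sub>R \<mu> w
        + ((\<mu> w' - \<mu> w) * inverse (\<mu> w) * inverse (\<mu> w')) *\<^sub>R (\<phi> + w') ^ n - (w - w')"
    proof -
      have "(\<mu> w' - \<mu> w) * inverse (\<mu> w) * inverse (\<mu> w') = inverse (\<mu> w) - inverse (\<mu> w')"
        using inv\<mu>[OF w] inv\<mu>[OF w'] by (simp add: field_simps)
      then show ?thesis unfolding G_def by (simp only: scaleR_diff_left scaleR_diff_right) simp
    qed
    have "norm (G w - G w') \<le> \<bar>inverse (\<mu> w)\<bar> * norm ((\<phi> + w) ^ n - (\<phi> + w') ^ n)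
        + \<bar>\<mu> w' - \<mu> w\<bar> * \<bar>inverse (\<mu> w)\<bar> * \<bar>inverse (\<mu> w')\<bar> * norm ((\<phi> + w') ^ n) + norm (w - w')"
      unfolding eq by (rule order_trans[OF norm_triangle_ineq4] add_mono order_trans[OF norm_triangle_ineq])+
        (simp_all add: abs_mult)
    also have "\<dots> \<le> 2 / c * (L * norm (w - w'))
        + B * L * norm (w - w') * (2 / c) * (2 / c) * R ^ n + norm (w - w')"
      using inv\<mu>[OF w] inv\<mu>[OF w'] lip[OF w w'] lip\<mu>[OF w' w] pw[OF w'] c B L
      by (intro add_mono mult_mono mult_nonneg_nonneg) (auto simp: norm_minus_commute)
    also have "\<dots> = K2 * norm (w - w')" by (simp add: K2_def algebra_simps)
    finally show ?thesis .
  qed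
  define \<kappa>0 where "\<kappa>0 = min (\<rho> / K1) (1 / (2 * K2))"
  define K where "K = K1 + B * L * K1"
  have \<kappa>0: "\<kappa>0 > 0" "\<kappa>0 * K1 \<le> \<rho>" "\<kappa>0 * K2 \<le> 1 / 2"
    using \<rho> K1 K2 by (auto simp: \<kappa>0_def min_def field_simps)
  have K: "K > 0" "K1 \<le> K" using K1 BL by (auto simp: K_def intro!: add_pos_nonneg)
  have main: "\<exists>w\<in>X. w = M (G w) \<and> norm w \<le> K * \<kappa> \<and> \<mu> w > 0 \<and> \<bar>\<mu> w - c\<bar> \<le> K * \<kappa>"
    if \<kappa>: "0 \<le> \<kappa>" "\<kappa> \<le> \<kappa>0" and M: "linear M" "\<And>f. norm (M f) \<le> \<kappa> * norm f"
      and X: "closed X" "0 \<in> X" "\<And>w. w \<in> X \<Longrightarrow> M (G w) \<in> X" for \<kappa> M X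
  proof -
    have \<kappa>1: "\<kappa> * K1 \<le> \<rho>" and \<kappa>2: "\<kappa> * K2 \<le> 1 / 2"
      using mult_right_mono[OF \<kappa>(2), of K1] mult_right_mono[OF \<kappa>(2), of K2] K1 K2 \<kappa>0 by linarith+
    have MG: "norm (M (G w)) \<le> \<kappa> * K1" if "norm w \<le> \<rho>" for w
      using M(2)[of "G w"] mult_left_mono[OF G1[OF that] \<kappa>(1)] by simp
    have "\<exists>!w. w \<in> X \<inter> cball 0 \<rho> \<and> M (G w) = w"
    proof (rule Banach_fix)
      show "complete (X \<inter> cball 0 \<rho>)"
        using X(1) by (simp add: complete_eq_closed closed_Int)
      show "X \<inter> cball 0 \<rho> \<noteq> {}" using X \<rho> by auto
      show "(\<lambda>w. M (G w)) ` (X \<inter> cball 0 \<rho>) \<subseteq> X \<inter> cball 0 \<rho>"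
        using X(3) MG \<kappa>1 by force
      show "dist (M (G w)) (M (G w')) \<le> 1 / 2 * dist w w'"
        if "w \<in> X \<inter> cball 0 \<rho>" "w' \<in> X \<inter> cball 0 \<rho>" for w w'
      proof -
        have "dist (M (G w)) (M (G w')) = norm (M (G w - G w'))"
          by (simp add: dist_norm linear_diff[OF M(1)])
        also have "\<dots> \<le> \<kappa> * norm (G w - G w')" by (rule M)
        also have "\<dots> \<le> \<kappa> * (K2 * norm (w - w'))"
          using that \<kappa> by (intro mult_left_mono G2) auto
        also have "\<dots> \<le> 1 / 2 * norm (w - w')"
          using mult_right_mono[OF \<kappa>2, of "norm (w - w')"] by (simp add: mult.assoc)
        finally show ?thesis by (simp add: dist_norm)
      qed
    qed auto
    then obtain w where w: "w \<in> X" "norm w \<le> \<rho>" "M (G w) = w" by auto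
    have "norm w \<le> \<kappa> * K1" using MG[OF w(2)] w(3) by simp
    moreover have "\<bar>\<mu> w - c\<bar> \<le> B * L * (\<kappa> * K1)"
      using near[OF w(2)] mult_left_mono[OF \<open>norm w \<le> \<kappa> * K1\<close> BL(1)] by linarith
    moreover have "\<kappa> * K1 \<le> K * \<kappa>" "B * L * (\<kappa> * K1) \<le> K * \<kappa>"
      using \<kappa> B L K1 by (auto simp: K_def algebra_simps)
    ultimately show ?thesis
      using w inv\<mu>[OF w(2)] by (intro bexI[of _ w]) auto
  qed
  show ?thesis
  proof (rule exI[of _ K], rule conjI[OF K(1)], rule exI[of _ \<kappa>0], rule conjI[OF \<kappa>0(1)], intro allI impI)
    fix \<kappa> :: real and M :: "'a \<Rightarrow> 'a" and X :: "'a set"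
    assume "0 \<le> \<kappa>" "\<kappa> \<le> \<kappa>0" "linear M" "\<forall>f. norm (M f) \<le> \<kappa> * norm f" "closed X" "0 \<in> X"
      "\<forall>w\<in>X. M ((\<phi> + w) ^ n /\<^sub>R l ((\<phi> + w) ^ n) - w) \<in> X"
    then show "\<exists>w\<in>X. w = M ((\<phi> + w) ^ n /\<^sub>R l ((\<phi> + w) ^ n) - w) \<and> norm w \<le> K * \<kappa> \<and>
       l ((\<phi> + w) ^ n) > 0 \<and> \<bar>l ((\<phi> + w) ^ n) - l (\<phi> ^ n)\<bar> \<le> K * \<kappa>"
      using main[of \<kappa> M X] unfolding G_def \<mu>_def c_def by simp
  qed
qed

section \<open>Continuity and derivatives of trigonometric series\<close>

lemma norm_cis_diff_le: "norm (cis a - cis b) \<le> \<bar>a - b\<bar>"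
proof -
  have "(norm (cis a - cis b))\<^sup>2 = (cos a - cos b)\<^sup>2 + (sin a - sin b)\<^sup>2"
    by (simp add: cmod_power2)
  also have "\<dots> = ((sin a)\<^sup>2 + (cos a)\<^sup>2) + ((sin b)\<^sup>2 + (cos b)\<^sup>2) - 2 * (cos a * cos b + sin a * sin b)"
    by (simp only: power2_diff) (simp add: algebra_simps)
  also have "\<dots> = 2 - 2 * cos (a - b)"
    by (simp add: cos_diff)
  also have "cos (a - b) = 1 - 2 * (sin ((a - b) / 2))\<^sup>2"
    unfolding cos_double_sin[symmetric] by (auto intro!: arg_cong[where f = cos] simp: field_simps)
  also have "2 - 2 * \<dots> = (2 * sin ((a - b) / 2))\<^sup>2"
    by (simp add: power_mult_distrib)
  finally have "norm (cis a - cis b) = \<bar>2 * sin ((a - b) / 2)\<bar>"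
    by - (rule power2_eq_imp_eq, simp_all)
  then have "norm (cis a - cis b) = 2 * \<bar>sin ((a - b) / 2)\<bar>"
    by (simp only: abs_mult abs_numeral)
  also have "\<dots> \<le> 2 * \<bar>(a - b) / 2\<bar>"
    by (intro mult_left_mono abs_sin_x_le_abs_x) auto
  finally show ?thesis by simp
qed

text \<open>
  Since exponentials have modulus 1, the Weierstrass test applies on the whole space.
\<close>
lemma continuous_on_trig_series:
  fixes c :: "'j \<Rightarrow> complex" and \<theta> :: "'j \<Rightarrow> 'b::topological_space \<Rightarrow> real"
  assumes c: "(\<lambda>j. norm (c j)) summable_on UNIV" and \<theta>: "\<And>j. continuous_on S (\<theta> j)"
  shows "continuous_on S (\<lambda>x. \<Sum>\<^sub>\<infinity>j. c j * cis (\<theta> j x))"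
proof (rule uniform_limit_theorem)
  show "uniform_limit S (\<lambda>F x. \<Sum>j\<in>F. c j * cis (\<theta> j x)) (\<lambda>x. \<Sum>\<^sub>\<infinity>j. c j * cis (\<theta> j x))
      (finite_subsets_at_top UNIV)"
    by (rule Weierstrass_m_test_general[OF _ c]) (simp add: norm_mult)
  show "\<forall>\<^sub>F F in finite_subsets_at_top UNIV. continuous_on S (\<lambda>x. \<Sum>j\<in>F. c j * cis (\<theta> j x))"
    by (intro always_eventually allI continuous_intros \<theta>)
qed simp

text \<open>
  The remainders of the difference quotients are dominated, uniformly in the increment, by twice the
  coefficients times the frequencies. The limit of the increment can therefore be taken termwise;
  a single moment of the coefficients is enough.
\<close>
lemma trig_series_has_vector_derivative:
  fixes c :: "'j \<Rightarrow> complex" and \<theta> \<alpha> :: "'j \<Rightarrow> real"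
  assumes c: "(\<lambda>j. norm (c j)) summable_on UNIV"
    and c\<alpha>: "(\<lambda>j. norm (c j) * \<bar>\<alpha> j\<bar>) summable_on UNIV"
  shows "((\<lambda>s. \<Sum>\<^sub>\<infinity>j. c j * cis (\<theta> j + s * \<alpha> j)) has_vector_derivative
      (\<Sum>\<^sub>\<infinity>j. (\<i> * of_real (\<alpha> j) * c j) * cis (\<theta> j))) (at 0)"
proof -
  \<comment> \<open>the remainder of the difference quotient of the \<open>j\<close>-th exponential\<close>
  define q where "q j h = (cis (\<theta> j + h * \<alpha> j) - cis (\<theta> j) - of_real (h * \<alpha> j) * \<i> * cis (\<theta> j)) / of_real h"
    for j h
  have qb: "norm (c j * q j h) \<le> 2 * (norm (c j) * \<bar>\<alpha> j\<bar>)" for j h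
  proof -
    have "norm (cis (\<theta> j + h * \<alpha> j) - cis (\<theta> j) - of_real (h * \<alpha> j) * \<i> * cis (\<theta> j)) \<le> 2 * (\<bar>h\<bar> * \<bar>\<alpha> j\<bar>)"
      using norm_triangle_ineq4[of "cis (\<theta> j + h * \<alpha> j) - cis (\<theta> j)" "of_real (h * \<alpha> j) * \<i> * cis (\<theta> j)"]
        norm_cis_diff_le[of "\<theta> j + h * \<alpha> j" "\<theta> j"]
      by (simp add: norm_mult abs_mult del: of_real_mult)
    then have "norm (q j h) \<le> 2 * \<bar>\<alpha> j\<bar>"
      unfolding q_def norm_divide by (cases "h = 0") (auto simp: field_simps)
    from mult_left_mono[OF this, of "norm (c j)"] show ?thesis
      by (simp add: norm_mult mult_ac)
  qed
  have qlim: "(q j \<longlongrightarrow> 0) (at 0)" for j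
  proof -
    have "((\<lambda>s. cis (\<theta> j + s * \<alpha> j)) has_vector_derivative of_real (\<alpha> j) * \<i> * cis (\<theta> j)) (at 0)"
    proof -
      have "((\<lambda>s. exp (\<i> * of_real (\<theta> j) + of_real s * (\<i> * of_real (\<alpha> j)))) has_vector_derivative
          \<i> * of_real (\<alpha> j) * exp (\<i> * of_real (\<theta> j))) (at 0)"
        by (rule has_vector_derivative_real_field[where f = "\<lambda>s. exp (\<i> * of_real (\<theta> j) + s * (\<i> * of_real (\<alpha> j)))"])
          (auto intro!: derivative_eq_intros)
      then show ?thesis
        by (simp add: cis_conv_exp algebra_simps)
    qed
    then have "(\<lambda>h. norm (cis (\<theta> j + h * \<alpha> j) - cis (\<theta> j) - h *\<^sub>R (of_real (\<alpha> j) * \<i> * cis (\<theta> j))) / norm h) \<midarrow>0\<rightarrow> 0"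
      by (simp add: has_vector_derivative_def has_derivative_at)
    then have "((\<lambda>h. norm (q j h)) \<longlongrightarrow> 0) (at 0)"
      by (simp add: q_def norm_divide scaleR_conv_of_real mult.assoc)
    then show ?thesis by (rule tendsto_norm_zero_cancel)
  qed
  define f where "f s = (\<Sum>\<^sub>\<infinity>j. c j * cis (\<theta> j + s * \<alpha> j))" for s
  define f' where "f' = (\<Sum>\<^sub>\<infinity>j. (\<i> * of_real (\<alpha> j) * c j) * cis (\<theta> j))"
  have "uniform_limit UNIV (\<lambda>F h. \<Sum>j\<in>F. c j * q j h) (\<lambda>h. \<Sum>\<^sub>\<infinity>j. c j * q j h) (finite_subsets_at_top UNIV)"
    by (rule Weierstrass_m_test_general[OF _ summable_on_cmult_right[OF c\<alpha>]]) (rule qb)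
  then have lim: "((\<lambda>h. \<Sum>\<^sub>\<infinity>j. c j * q j h) \<longlongrightarrow> 0) (at 0)"
  proof (rule swap_uniform_limit[rotated 2])
    show "\<forall>\<^sub>F F in finite_subsets_at_top UNIV. ((\<lambda>h. \<Sum>j\<in>F. c j * q j h) \<longlongrightarrow> 0) (at 0)"
      by (intro always_eventually allI tendsto_null_sum tendsto_mult_right_zero qlim)
  qed auto
  have s1: "(\<lambda>j. c j * cis (y j)) summable_on UNIV" for y
    by (rule abs_summable_summable) (simp add: norm_mult c)
  have s2: "(\<lambda>j. (\<i> * of_real (\<alpha> j) * c j) * cis (\<theta> j)) summable_on UNIV"
    by (rule abs_summable_summable) (use c\<alpha> in \<open>simp add: norm_mult mult.commute\<close>)
  have infsum_diff: "(\<Sum>\<^sub>\<infinity>j. g j - k j) = infsum g UNIV - infsum k UNIV" "(\<lambda>j. g j - k j) summable_on UNIV"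
    if "g summable_on UNIV" "k summable_on UNIV" for g k :: "'j \<Rightarrow> complex"
    using infsum_add[of g UNIV "\<lambda>j. - k j"] summable_on_add[of g UNIV "\<lambda>j. - k j"] that
    by (simp_all add: infsum_uminus summable_on_uminus)
  have eq: "f h - f 0 - h *\<^sub>R f' = of_real h * (\<Sum>\<^sub>\<infinity>j. c j * q j h)" for h
  proof -
    have "f h - f 0 - h *\<^sub>R f' = (\<Sum>\<^sub>\<infinity>j. c j * cis (\<theta> j + h * \<alpha> j) - c j * cis (\<theta> j)
        - of_real h * ((\<i> * of_real (\<alpha> j) * c j) * cis (\<theta> j)))"
      unfolding f_def f'_def scaleR_conv_of_real
      using s1 s2 by (simp add: infsum_cmult_right' infsum_diff summable_on_cmult_right)
    also have "\<dots> = (\<Sum>\<^sub>\<infinity>j. of_real h * (c j * q j h))"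
      by (rule infsum_cong) (cases "h = 0", simp_all add: q_def field_simps)
    finally show ?thesis by (simp add: infsum_cmult_right')
  qed
  have "(\<lambda>h. norm (f h - f 0 - h *\<^sub>R f') / norm h) \<midarrow>0\<rightarrow> 0"
  proof (rule Lim_transform_eventually[OF tendsto_norm_zero[OF lim]])
    show "\<forall>\<^sub>F h in at 0. norm (\<Sum>\<^sub>\<infinity>j. c j * q j h) = norm (f h - f 0 - h *\<^sub>R f') / norm h"
      unfolding eventually_at_filter eq by (intro always_eventually) (simp add: norm_mult)
  qed
  then have "(f has_vector_derivative f') (at 0)"
    by (simp add: has_vector_derivative_def has_derivative_at bounded_linear_scaleR_left)
  then show ?thesis by (simp add: f_def[abs_def] f'_def)
qed

section \<open>Lattice modes and their eigenvalues\<close>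

text \<open>
  The modes each of whose blocks is a multiple of the corresponding block of \<open>jt\<close>, with a factor of
  the parity of \<open>m\<close>. A block where \<open>jt\<close> vanishes must vanish as well.
\<close>
definition parity_multiples :: "int^2^'d \<Rightarrow> nat \<Rightarrow> (int^2^'d) set" where
  "parity_multiples jt m = {j. \<forall>k. \<exists>n. (even n \<longleftrightarrow> even m) \<and> j $ k = n *s (jt $ k)}"

text \<open>
  The orbit of \<open>jt\<close> under sign changes of blocks: the exponentials that make up the cosine mode of
  \<open>jt\<close>.
\<close>
definition sign_orbit :: "int^2^'d \<Rightarrow> (int^2^'d) set" where
  "sign_orbit jt = {j. \<forall>k. j $ k = jt $ k \<or> j $ k = - jt $ k}"

definition flip :: "'d \<Rightarrow> int^2^'d \<Rightarrow> int^2^'d" where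
  "flip k j = (\<chi> l. if l = k then - j $ l else j $ l)"

lemma flip_nth: "flip k j $ l = (if l = k then - j $ l else j $ l)"
  by (simp add: flip_def)

lemma flip_add: "flip k (i + j) = flip k i + flip k j"
  by (simp add: vec_eq_iff flip_nth)

lemma flip_flip: "flip k (flip k j) = j"
  by (simp add: vec_eq_iff flip_nth)

lemma int_inner_uminus: "int_inner (- j) l = - int_inner j l"
  by (simp add: int_inner_def sum_negf)

lemma int_inner_add: "int_inner (i + j) l = int_inner i l + int_inner j l"
  by (simp add: int_inner_def sum.distrib distrib_right)

lemma int_inner_scale: "int_inner (n *s j) l = of_int n * int_inner j l"
  by (simp add: int_inner_def sum_distrib_left mult.assoc)

lemma scale_uminus: "(- n) *s j = - (n *s j)" for n :: int
  by (simp add: vec_eq_iff)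

lemma freq_sq_flip: "freq_sq (flip k j) lam = freq_sq j lam"
  unfolding freq_sq_def by (rule sum.cong) (auto simp: flip_nth int_inner_uminus)

lemma parity_multiplesD:
  "j \<in> parity_multiples jt m \<Longrightarrow> \<exists>n. (even n \<longleftrightarrow> even m) \<and> j $ k = n *s (jt $ k)"
  by (simp only: parity_multiples_def mem_Collect_eq)

lemma parity_multiples_add:
  assumes "i \<in> parity_multiples jt m" "j \<in> parity_multiples jt n"
  shows "i + j \<in> parity_multiples jt (m + n)"
  unfolding parity_multiples_def mem_Collect_eq
proof
  fix k
  obtain a b where "even a \<longleftrightarrow> even m" "i $ k = a *s (jt $ k)" "even b \<longleftrightarrow> even n" "j $ k = b *s (jt $ k)"
    using assms[THEN parity_multiplesD, of k] by blast
  then show "\<exists>c. (even c \<longleftrightarrow> even (m + n)) \<and> (i + j) $ k = c *s (jt $ k)"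
    by (intro exI[of _ "a + b"]) (auto simp: vector_sadd_rdistrib)
qed

lemma zero_in_parity_multiples: "0 \<in> parity_multiples jt 0"
  by (auto simp: parity_multiples_def intro!: exI[of _ "0::int"])

lemma sign_orbit_subset: "sign_orbit jt \<subseteq> parity_multiples jt 1"
proof
  fix j assume j: "j \<in> sign_orbit jt"
  show "j \<in> parity_multiples jt 1"
    unfolding parity_multiples_def mem_Collect_eq
  proof
    fix k
    have "j $ k = 1 *s (jt $ k) \<or> j $ k = (-1) *s (jt $ k)"
      using j by (auto simp: sign_orbit_def vec_eq_iff)
    moreover have "odd (1::int)" "odd (-1::int)" by auto
    ultimately show "\<exists>n::int. (even n \<longleftrightarrow> even (1::nat)) \<and> j $ k = n *s (jt $ k)"
      by (metis odd_one)
  qed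
qed

lemma flip_parity_multiples: "flip k j \<in> parity_multiples jt m \<longleftrightarrow> j \<in> parity_multiples jt m"
proof -
  have *: "flip k j \<in> parity_multiples jt m" if jm: "j \<in> parity_multiples jt m" for j
    unfolding parity_multiples_def mem_Collect_eq
  proof
    fix l
    obtain n where n: "even n \<longleftrightarrow> even m" "j $ l = n *s (jt $ l)"
      using parity_multiplesD[OF jm, of l] by blast
    show "\<exists>n. (even n \<longleftrightarrow> even m) \<and> flip k j $ l = n *s (jt $ l)"
    proof (cases "l = k")
      case True
      then have "flip k j $ l = - j $ l" by (simp add: flip_nth)
      then have "flip k j $ l = (- n) *s (jt $ l)" by (simp only: n(2) scale_uminus)
      then show ?thesis using n(1) by (metis even_minus)
    next
      case False
      then show ?thesis using n by (auto simp only: flip_nth if_False)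
    qed
  qed
  from *[of j] *[of "flip k j"] show ?thesis by (auto simp: flip_flip)
qed

lemma flip_sign_orbit: "flip k j \<in> sign_orbit jt \<longleftrightarrow> j \<in> sign_orbit jt"
proof -
  have "(flip k j $ l = jt $ l \<or> flip k j $ l = - jt $ l) \<longleftrightarrow> (j $ l = jt $ l \<or> j $ l = - jt $ l)" for l
    using neg_equal_iff_equal[of "j $ l" "- jt $ l"] by (auto simp: flip_nth)
  then show ?thesis by (simp add: sign_orbit_def)
qed

lemma sign_orbit_eq_flipped:
  assumes "j \<in> sign_orbit jt"
  shows "j = (\<chi> k. if k \<in> {k. j $ k \<noteq> jt $ k} then - jt $ k else jt $ k)" (is "j = ?j")
proof (rule iffD2[OF vec_eq_iff], rule allI)
  fix k
  have "j $ k = jt $ k \<or> j $ k = - jt $ k"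
    using assms by (simp add: sign_orbit_def)
  then show "j $ k = ?j $ k" by (cases "j $ k = jt $ k") simp_all
qed

lemma sign_orbit_invariant:
  assumes h: "\<And>k j. h (flip k j) = h j" and j: "j \<in> sign_orbit jt"
  shows "h j = h jt"
proof -
  have "h (\<chi> k. if k \<in> A then - jt $ k else jt $ k) = h jt" if "finite A" for A
    using that
  proof (induction A)
    case (insert k A)
    have "(\<chi> l. if l \<in> insert k A then - jt $ l else jt $ l)
        = flip k (\<chi> l. if l \<in> A then - jt $ l else jt $ l)"
      using insert.hyps by (auto simp: vec_eq_iff flip_nth)
    then show ?case using insert.IH h by simp
  qed simp
  from this[of "{k. j $ k \<noteq> jt $ k}"] show ?thesis
    using sign_orbit_eq_flipped[OF j] by simp
qed

lemma finite_sign_orbit: "finite (sign_orbit jt)"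
proof (rule finite_subset)
  show "sign_orbit jt \<subseteq> range (\<lambda>A. \<chi> k. if k \<in> A then - jt $ k else jt $ k)"
  proof
    fix j assume "j \<in> sign_orbit jt"
    from sign_orbit_eq_flipped[OF this] show "j \<in> range (\<lambda>A. \<chi> k. if k \<in> A then - jt $ k else jt $ k)" by blast
  qed
qed simp

lemma sign_orbit_self: "jt \<in> sign_orbit jt" "- jt \<in> sign_orbit jt"
  by (auto simp: sign_orbit_def)

text \<open>
  The reason why there is no small divisor problem: the difference is the sum of
  \<open>(n_k^2 - 1) \<omega>_k^2\<close>, where \<open>\<omega>_k\<close> is the frequency of the \<open>k\<close>-th block of \<open>jt\<close>. For odd \<open>n_k\<close>
  every term is nonnegative, and outside the sign orbit one of the factors is at least 8.
\<close>
lemma freq_sq_gap: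
  assumes j: "j \<in> parity_multiples jt 1" "j \<notin> sign_orbit jt"
    and \<delta>: "\<delta> \<ge> 0" "\<And>k. jt $ k \<noteq> 0 \<Longrightarrow> \<delta> \<le> \<bar>int_inner (jt $ k) (lam $ k)\<bar>"
  shows "8 * \<delta>\<^sup>2 \<le> freq_sq j lam - freq_sq jt lam"
proof -
  define w where "w k = int_inner (jt $ k) (lam $ k)" for k
  have "\<exists>n. \<forall>k. odd (n k) \<and> j $ k = n k *s (jt $ k)"
    using j(1) by (intro choice) (simp add: parity_multiples_def)
  then obtain n where n: "\<And>k. odd (n k)" "\<And>k. j $ k = n k *s (jt $ k)" by blast
  have sq: "(of_int (n k) :: real)\<^sup>2 \<ge> 1" for k
  proof -
    have "1 \<le> \<bar>n k\<bar>" using n(1)[of k] by presburger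
    then have "1 \<le> (n k)\<^sup>2" using power_mono[of 1 "\<bar>n k\<bar>" 2] by simp
    then show ?thesis by (metis of_int_1_le_iff of_int_power)
  qed
  obtain k where k: "j $ k \<noteq> jt $ k" "j $ k \<noteq> - jt $ k"
    using j(2) by (auto simp: sign_orbit_def)
  have jt: "jt $ k \<noteq> 0" using k n(2)[of k] by (auto simp: vec_eq_iff)
  have "n k \<noteq> 1" "n k \<noteq> -1" using k n(2)[of k] by (auto simp: vec_eq_iff)
  then have "3 \<le> \<bar>n k\<bar>" using n(1)[of k] by presburger
  then have "9 \<le> (n k)\<^sup>2" using power_mono[of 3 "\<bar>n k\<bar>" 2] by simp
  then have nk: "(of_int (n k) :: real)\<^sup>2 \<ge> 9"
    by (metis of_int_le_iff of_int_numeral of_int_power)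
  have "\<delta>\<^sup>2 \<le> (w k)\<^sup>2"
    using power_mono[OF \<delta>(2)[OF jt] \<delta>(1), of 2] by (simp add: w_def)
  then have "8 * \<delta>\<^sup>2 \<le> ((of_int (n k))\<^sup>2 - 1) * (w k)\<^sup>2"
    using nk by (intro mult_mono) auto
  also have "\<dots> \<le> (\<Sum>k\<in>UNIV. ((of_int (n k))\<^sup>2 - 1) * (w k)\<^sup>2)"
    using sq by (intro member_le_sum) auto
  also have "\<dots> = freq_sq j lam - freq_sq jt lam"
    by (simp add: freq_sq_def n(2) int_inner_scale w_def algebra_simps power_mult_distrib sum_subtractf)
  finally show ?thesis .
qed

definition phase :: "real^2^'d \<Rightarrow> int^2^'d \<Rightarrow> real^'d \<Rightarrow> real" where
  "phase lam j x = (\<Sum>k\<in>UNIV. int_inner (j $ k) (lam $ k) * x $ k)"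

lemma phase_add: "phase lam (i + j) x = phase lam i x + phase lam j x"
  by (simp add: phase_def int_inner_add distrib_right sum.distrib)

lemma cis_sum: "finite A \<Longrightarrow> cis (sum f A) = (\<Prod>k\<in>A. cis (f k))"
  by (induction rule: finite_induct) (simp_all flip: cis_mult)

text \<open>
  Exponential series are used for the calculus and the algebra. If the coefficients are invariant
  under sign changes of the blocks, then averaging the series with its reflected copy replaces the
  exponential in that block by a cosine, one block after the other.
\<close>
lemma exponential_eq_cosine_series:
  fixes c :: "int^2^'d \<Rightarrow> complex"
  assumes c: "\<And>k j. c (flip k j) = c j"
    and S: "((\<lambda>j. c j * cis (phase lam j x)) has_sum S) UNIV"
  shows "((\<lambda>j. c j * of_real (cos_mode lam j x)) has_sum S) UNIV"
proof -
  define y where "y j k = int_inner (j $ k) (lam $ k) * x $ k" for j k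
  have yf: "y (flip k j) l = (if l = k then - y j l else y j l)" for k j l
    by (simp add: y_def flip_nth int_inner_uminus)
  define G where "G A j = c j * (\<Prod>k\<in>A. of_real (cos (y j k))) * (\<Prod>k\<in>UNIV - A. cis (y j k))" for A j
  have "(G A has_sum S) UNIV" if "finite A" for A
    using that
  proof (induction A)
    case empty
    then show ?case
      using S by (simp add: G_def[abs_def] phase_def cis_sum y_def)
  next
    case (insert k A)
    define b where "b j = c j * (\<Prod>k\<in>A. of_real (cos (y j k))) * (\<Prod>k\<in>UNIV - insert k A. cis (y j k))" for j
    have bf: "b (flip k j) = b j" for j
      unfolding b_def c
      by (intro arg_cong2[where f = "(*)"] refl prod.cong) (use insert.hyps in \<open>auto simp: yf\<close>)
    have UA: "UNIV - A = insert k (UNIV - insert k A)" using insert.hyps by auto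
    have Gb: "G A = (\<lambda>j. b j * cis (y j k))"
      unfolding G_def[abs_def] b_def by (subst UA, subst prod.insert) (auto simp: mult_ac)
    have 1: "((\<lambda>j. b j * cis (y j k)) has_sum S) UNIV"
      using insert.IH by (simp add: Gb)
    have bij: "bij_betw (flip k) UNIV UNIV"
      by (rule bij_betwI[of _ _ _ "flip k"]) (auto simp: flip_flip)
    have 2: "((\<lambda>j. b j * cis (- y j k)) has_sum S) UNIV"
      using has_sum_reindex_bij_betw[OF bij, of "\<lambda>j. b j * cis (y j k)" S] 1 by (simp add: bf yf)
    have "((\<lambda>j. 1 / 2 * (b j * cis (y j k) + b j * cis (- y j k))) has_sum 1 / 2 * (S + S)) UNIV"
      by (intro has_sum_cmult_right has_sum_add 1 2)
    moreover have "1 / 2 * (b j * cis (y j k) + b j * cis (- y j k)) = G (insert k A) j" for j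
    proof -
      have "cis (y j k) + cis (- y j k) = 2 * of_real (cos (y j k))"
        by (simp add: complex_eq_iff)
      then have "1 / 2 * (b j * cis (y j k) + b j * cis (- y j k)) = b j * of_real (cos (y j k))"
        by (simp flip: distrib_left)
      then show ?thesis using insert.hyps by (simp add: G_def b_def mult_ac)
    qed
    ultimately show ?case by simp
  qed
  from this[of UNIV] show ?thesis
    by (simp add: G_def[abs_def] cos_mode_def y_def)
qed

definition block_vector :: "'d \<Rightarrow> int^2 \<Rightarrow> real^2^'d" where
  "block_vector k j = axis k (\<chi> i. real_of_int (j $ i))"

lemma int_inner_eq_inner: "int_inner j (lam $ k) = block_vector k j \<bullet> lam"
proof -
  have "block_vector k j \<bullet> lam = (\<chi> i. real_of_int (j $ i)) \<bullet> lam $ k"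
    by (simp add: block_vector_def inner_axis')
  then show ?thesis by (simp add: int_inner_def inner_vec_def)
qed

lemma C1_on_freq_sq: "C1_on S (\<lambda>lam. freq_sq jt lam - \<tau>)"
proof -
  define a where "a k = block_vector k (jt $ k)" for k
  define f' where "f' lam = (\<Sum>k\<in>UNIV. (2 * (a k \<bullet> lam)) *\<^sub>R blinfun_inner_right (a k))" for lam
  have "((\<lambda>lam. freq_sq jt lam - \<tau>) has_derivative blinfun_apply (f' lam)) (at lam)" for lam
    unfolding freq_sq_def int_inner_eq_inner a_def[symmetric] f'_def
    by (auto intro!: derivative_eq_intros ext simp: blinfun.sum_left blinfun.scaleR_left sum_distrib_left mult_ac)
  moreover have "continuous_on S f'"
    unfolding f'_def by (intro continuous_intros)
  ultimately show ?thesis unfolding C1_on_def by blast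
qed

section \<open>The measure of the admissible parameters\<close>

text \<open>
  Translates of the strip by multiples of \<open>2 \<delta>\<close> in the direction of \<open>b\<close>, measured by the linear form
  \<open>a\<close>, are disjoint, and \<open>N\<close> of them fit into a box of volume \<open>1 + 4 \<delta> N\<close>. Comparing volumes for
  large \<open>N\<close> gives the bound.
\<close>
lemma measure_strip_le:
  fixes a b l :: "'a::euclidean_space"
  assumes b: "b \<in> Basis" and ab: "\<bar>a \<bullet> b\<bar> \<ge> 1" and \<delta>: "\<delta> \<ge> 0"
  defines "B \<equiv> {x \<in> box l (l + One). \<bar>a \<bullet> x\<bar> < \<delta>}"
  shows "B \<in> lmeasurable" and "measure lebesgue B \<le> 4 * \<delta>"
proof -
  have Beq: "B = box l (l + One) \<inter> {x. a \<bullet> x < \<delta>} \<inter> {x. a \<bullet> x > - \<delta>}"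
    by (auto simp: B_def abs_less_iff)
  have "open B"
    unfolding Beq by (intro open_Int open_box open_halfspace_lt open_halfspace_gt)
  moreover have "bounded B"
    by (rule bounded_subset[OF bounded_box[of l "l + One"]]) (auto simp: B_def)
  ultimately show B: "B \<in> lmeasurable"
    by (rule lmeasurable_open[rotated])
  have N: "real N * measure lebesgue B \<le> 1 + 4 * \<delta> * real N" for N :: nat
  proof -
    \<comment> \<open>the \<open>m\<close>-th translate is shifted by \<open>2 \<delta> m\<close> as measured by \<open>a\<close>\<close>
    define v where "v m = (2 * \<delta> * real m / (a \<bullet> b)) *\<^sub>R b" for m :: nat
    define L where "L = 2 * \<delta> * real N"
    have L: "L \<ge> 0" using \<delta> by (simp add: L_def)
    define T where "T m = (+) (v m) ` B" for m
    have av: "a \<bullet> v m = 2 * \<delta> * real m" for m using ab by (auto simp: v_def)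
    have disj: "pairwise (\<lambda>i j. disjnt (T i) (T j)) {..<N}"
    proof (rule pairwiseI)
      have *: "disjnt (T i) (T j)" if "i < j" for i j
      proof (rule ccontr)
        assume "\<not> disjnt (T i) (T j)"
        then obtain x y where "x \<in> B" "y \<in> B" "v i + x = v j + y"
          by (auto simp: disjnt_def T_def)
        then have "a \<bullet> v i + a \<bullet> x = a \<bullet> v j + a \<bullet> y" "\<bar>a \<bullet> x\<bar> < \<delta>" "\<bar>a \<bullet> y\<bar> < \<delta>"
          by (auto simp: B_def simp flip: inner_add_right)
        moreover have "2 * \<delta> * (real i + 1) \<le> 2 * \<delta> * real j"
          using \<delta> that by (intro mult_left_mono) auto
        ultimately show False
          unfolding av by (simp add: distrib_left)
      qed
      fix i j :: nat assume "i \<noteq> j"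
      then show "disjnt (T i) (T j)" using *[of i j] *[of j i] by (metis disjnt_sym linorder_neqE_nat)
    qed
    let ?C = "cbox (l - L *\<^sub>R b) (l + One + L *\<^sub>R b)"
    have sub: "(\<Union>m<N. T m) \<subseteq> ?C"
    proof (clarsimp simp: T_def)
      fix m x assume m: "m < N" and x: "x \<in> B"
      have "\<bar>2 * \<delta> * real m / (a \<bullet> b)\<bar> \<le> L"
      proof -
        have "\<bar>2 * \<delta> * real m / (a \<bullet> b)\<bar> = 2 * \<delta> * real m / \<bar>a \<bullet> b\<bar>"
          using \<delta> by (simp add: abs_mult)
        also have "\<dots> \<le> 2 * \<delta> * real m / 1"
          using ab \<delta> by (intro divide_left_mono) auto
        also have "\<dots> \<le> L" using m \<delta> by (auto simp: L_def intro!: mult_left_mono)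
        finally show ?thesis .
      qed
      then have "\<bar>v m \<bullet> i\<bar> \<le> L * (b \<bullet> i)" if "i \<in> Basis" for i
        using that b by (auto simp: v_def inner_Basis)
      then show "v m + x \<in> ?C"
        using x by (fastforce simp: B_def mem_box inner_simps abs_le_iff)
    qed
    have C: "measure lebesgue ?C = 1 + 2 * L"
    proof -
      have "measure lebesgue ?C = (\<Prod>i\<in>Basis. (l + One + L *\<^sub>R b) \<bullet> i - (l - L *\<^sub>R b) \<bullet> i)"
        using L b by (simp add: content_cbox_if box_eq_empty inner_simps inner_Basis)
      also have "\<dots> = (\<Prod>i\<in>Basis. if i = b then 1 + 2 * L else 1)"
        using b by (intro prod.cong) (auto simp: inner_simps inner_Basis)
      also have "\<dots> = 1 + 2 * L" using b by (simp add: prod.delta)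
      finally show ?thesis .
    qed
    have "real N * measure lebesgue B = (\<Sum>m<N. measure lebesgue (T m))"
      by (simp add: T_def measure_translation)
    also have "\<dots> = measure lebesgue (\<Union>m<N. T m)"
      using disj by (intro measure_UNION'[symmetric]) (auto simp: T_def B measurable_translation)
    also have "\<dots> \<le> measure lebesgue ?C"
      using sub by (intro measure_mono_fmeasurable) (auto simp: T_def intro!: sets.finite_UN fmeasurableD measurable_translation B)
    finally show ?thesis unfolding C by (simp add: L_def)
  qed
  show "measure lebesgue B \<le> 4 * \<delta>"
  proof (rule ccontr)
    assume "\<not> ?thesis"
    then obtain N :: nat where "real N * (measure lebesgue B - 4 * \<delta>) > 1"
      using reals_Archimedean3[of "measure lebesgue B - 4 * \<delta>"] by auto
    then show False using N[of N] by (simp add: algebra_simps)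
  qed
qed

definition nonresonant_params :: "int^2^'d \<Rightarrow> real \<Rightarrow> (real^2^'d) set" where
  "nonresonant_params jt \<delta> = {lam \<in> param_cube. irrational_param lam \<and>
     (\<forall>k. jt $ k \<noteq> 0 \<longrightarrow> \<delta> \<le> \<bar>int_inner (jt $ k) (lam $ k)\<bar>)}"

lemma param_cube_eq_box: "param_cube = box (\<chi> k i. 1/2) ((\<chi> k i. 1/2) + One :: real^2^'d)"
proof -
  have B: "(Basis :: (real^2^'d) set) = {axis k (axis i 1) | k i. True}"
    by (auto simp: Basis_vec_def)
  have BI: "(\<forall>b\<in>Basis. P b) \<longleftrightarrow> (\<forall>k i. P (axis k (axis i 1)))" for P :: "real^2^'d \<Rightarrow> bool"
    unfolding B by blast
  have *: "((\<chi> k i. 1/2) + One :: real^2^'d) \<bullet> axis k (axis i 1) = 3/2" for k i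
  proof -
    have "axis k (axis i 1) \<in> (Basis :: (real^2^'d) set)" using B by blast
    then have "(One :: real^2^'d) \<bullet> axis k (axis i 1) = 1" by simp
    then show ?thesis by (simp only: inner_add_left) (simp add: inner_axis)
  qed
  have "x \<in> box (\<chi> k i. 1/2) ((\<chi> k i. 1/2) + One) \<longleftrightarrow>
      (\<forall>k i. 1/2 < x $ k $ i \<and> x $ k $ i < 3/2)" for x :: "real^2^'d"
    unfolding mem_box BI * by (simp add: inner_axis)
  then show ?thesis by (auto simp: param_cube_def)
qed

lemma measure_param_cube: "measure lebesgue (param_cube :: (real^2^'d) set) = 1"
  unfolding param_cube_eq_box by (simp add: inner_add_left)

lemma irrational_param_iff:
  "irrational_param lam \<longleftrightarrow> (\<forall>k j m. j \<noteq> 0 \<longrightarrow> block_vector k j \<bullet> lam \<noteq> of_int m)"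
proof -
  have "infdist x \<int> \<noteq> 0 \<longleftrightarrow> (\<forall>m. x \<noteq> of_int m)" for x :: real
    using in_closed_iff_infdist_zero[of "\<int> :: real set" x] closed_Ints by (auto elim: Ints_cases)
  then show ?thesis
    unfolding irrational_param_def int_inner_eq_inner by blast
qed

text \<open>
  A block of \<open>jt\<close> that is not 0 has an integer entry of modulus at least 1, so each condition on the
  frequencies removes a strip of measure at most \<open>4 \<delta>\<close>; irrationality removes countably many
  hyperplanes.
\<close>
lemma measure_nonresonant_params:
  fixes jt :: "int^2^'d"
  assumes \<delta>: "\<delta> \<ge> 0"
  shows "nonresonant_params jt \<delta> \<in> sets lebesgue"
    and "measure lebesgue (nonresonant_params jt \<delta>) \<ge> 1 - real CARD('d) * (4 * \<delta>)"
proof -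
  define l :: "real^2^'d" where "l = (\<chi> k i. 1/2)"
  have cube: "param_cube = box l (l + One)"
    by (simp add: l_def param_cube_eq_box)
  define strip where "strip k = {x \<in> box l (l + One). \<bar>block_vector k (jt $ k) \<bullet> x\<bar> < \<delta>}" for k
  define I where "I = {k. jt $ k \<noteq> 0}"
  have strip: "strip k \<in> lmeasurable" "measure lebesgue (strip k) \<le> 4 * \<delta>" if "k \<in> I" for k
  proof -
    have "jt $ k \<noteq> 0" using that by (simp add: I_def)
    then obtain i where i: "jt $ k $ i \<noteq> 0" by (metis vec_eq_iff zero_index)
    have b: "axis k (axis i 1) \<in> (Basis :: (real^2^'d) set)" by (auto simp: Basis_vec_def)
    have "block_vector k (jt $ k) \<bullet> axis k (axis i 1) = of_int (jt $ k $ i)"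
      by (simp add: block_vector_def inner_axis)
    moreover have "\<bar>real_of_int (jt $ k $ i)\<bar> \<ge> 1" using i by linarith
    ultimately have ab: "\<bar>block_vector k (jt $ k) \<bullet> axis k (axis i 1)\<bar> \<ge> 1" by simp
    show "strip k \<in> lmeasurable" "measure lebesgue (strip k) \<le> 4 * \<delta>"
      unfolding strip_def by (rule measure_strip_le[OF b ab \<delta>])+
  qed
  \<comment> \<open>the parameters at which some block is rational: countably many hyperplanes\<close>
  define Q where "Q = (\<Union>(k, j, m) \<in> {(k :: 'd, j, m). j \<noteq> 0}. {x. block_vector k j \<bullet> x = of_int m})"
  have Q: "negligible Q"
    unfolding Q_def
  proof (rule negligible_countable_Union)
    have "countable (UNIV :: ('d \<times> (int^2) \<times> int) set)"
      by (rule countableI_type)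
    then show "countable ((\<lambda>(k, j, m). {x. block_vector k j \<bullet> x = of_int m}) ` {(k :: 'd, j, m). j \<noteq> 0})"
      by (intro countable_image) (rule countable_subset[rotated], auto)
    fix S assume "S \<in> (\<lambda>(k, j, m). {x. block_vector k j \<bullet> x = of_int m}) ` {(k :: 'd, j, m). j \<noteq> 0}"
    then obtain k j m where S: "S = {x. block_vector k j \<bullet> x = of_int m}" "j \<noteq> 0" by auto
    then obtain i where i: "j $ i \<noteq> 0" by (metis vec_eq_iff zero_index)
    have "block_vector k j $ k $ i \<noteq> 0" using i by (simp add: block_vector_def)
    then have "block_vector k j \<noteq> 0" by auto
    then show "negligible S" unfolding S by (intro negligible_hyperplane) auto
  qed
  have QL: "Q \<in> lmeasurable" "measure lebesgue Q = 0"
    using Q by (auto simp: negligible_iff_measure)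
  let ?L = "nonresonant_params jt \<delta>" and ?B = "\<Union>k\<in>I. strip k"
  have L: "?L = param_cube - ?B - Q"
    unfolding nonresonant_params_def irrational_param_iff int_inner_eq_inner
    by (auto simp: I_def strip_def Q_def cube not_less)
  have B: "?B \<in> lmeasurable" by (intro fmeasurable.finite_UN strip) auto
  have cubeL: "(param_cube :: (real^2^'d) set) \<in> lmeasurable" by (simp add: cube)
  show Ls: "?L \<in> sets lebesgue"
    unfolding L using B QL cubeL by (intro sets.Diff) auto
  then have LL: "?L \<in> lmeasurable"
    using cubeL by (rule fmeasurableI2[rotated 2]) (auto simp: L)
  have "1 = measure lebesgue (param_cube :: (real^2^'d) set)"
    by (rule measure_param_cube[symmetric])
  also have "\<dots> \<le> measure lebesgue (?L \<union> (?B \<union> Q))"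
    by (rule measure_mono_fmeasurable) (use L LL B QL cubeL in auto)
  also have "\<dots> \<le> measure lebesgue ?L + (measure lebesgue ?B + measure lebesgue Q)"
    using Ls B QL by (intro order_trans[OF measure_Un_le] add_left_mono measure_Un_le) auto
  also have "measure lebesgue ?B \<le> (\<Sum>k\<in>I. measure lebesgue (strip k))"
    by (rule measure_UNION_le) (auto dest: strip)
  also have "\<dots> \<le> real (card I) * (4 * \<delta>)"
    by (rule sum_bounded_above) (rule strip)
  also have "\<dots> \<le> real CARD('d) * (4 * \<delta>)"
    using \<delta> by (intro mult_right_mono) (auto intro: card_mono)
  finally show "measure lebesgue ?L \<ge> 1 - real CARD('d) * (4 * \<delta>)"
    using QL by linarith
qed

section \<open>From coefficients to standing waves\<close>

abbreviation plane_wave :: "real^2^'d \<Rightarrow> real^'d \<Rightarrow> int^2^'d \<Rightarrow> complex" where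
  "plane_wave lam x j \<equiv> cis (phase lam j x)"

definition flip_invariant :: "(int^2^'d) l1 \<Rightarrow> bool" where
  "flip_invariant f \<longleftrightarrow> (\<forall>k j. coef f (flip k j) = coef f j)"

lemma plane_wave_add: "plane_wave lam x (i + j) = plane_wave lam x i * plane_wave lam x j"
  by (simp add: phase_add cis_mult)

lemma plane_wave_norm: "norm (plane_wave lam x j) = 1"
  by simp

lemmas plane_eval_has_sum = l1_eval_has_sum[OF plane_wave_add plane_wave_norm]
  and plane_eval_add = l1_eval_add[OF plane_wave_add plane_wave_norm]
  and plane_eval_scaleR = l1_eval_scaleR[OF plane_wave_add plane_wave_norm]
  and plane_eval_power = l1_eval_power[OF plane_wave_add plane_wave_norm]

lemma cosine_series_l1_eval:
  assumes "flip_invariant f"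
  shows "cosine_series lam (\<lambda>j. of_real (coef f j)) (\<lambda>x. l1_eval (plane_wave lam x) f)"
  unfolding cosine_series_def
  by (intro allI exponential_eq_cosine_series plane_eval_has_sum)
    (use assms in \<open>auto simp: flip_invariant_def\<close>)

lemma l1_eval_real:
  assumes "flip_invariant f"
  shows "l1_eval (plane_wave lam x) f \<in> \<real>"
proof -
  have "((\<lambda>j. of_real (coef f j) * of_real (cos_mode lam j x)) has_sum l1_eval (plane_wave lam x) f) UNIV"
    using cosine_series_l1_eval[OF assms] by (auto simp: cosine_series_def)
  from has_sum_Im[OF this] have "((\<lambda>j. 0) has_sum Im (l1_eval (plane_wave lam x) f)) (UNIV :: (int^2^'a) set)"
    by simp
  then have "Im (l1_eval (plane_wave lam x) f) = 0"
    using has_sum_0_simp has_sum_unique by blast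
  then show ?thesis by (simp add: complex_is_Real_iff)
qed

lemma l2_norm_le_norm:
  assumes "norm z = 1"
  shows "l2_norm (\<lambda>j. z * of_real (coef f j)) \<le> norm f"
proof -
  have s: "(\<lambda>j. norm f * \<bar>coef f j\<bar>) summable_on UNIV"
    by (intro summable_on_cmult_right coef_abs_summable)
  have le: "(norm (z * of_real (coef f j)))\<^sup>2 \<le> norm f * \<bar>coef f j\<bar>" for j
    using mult_right_mono[OF abs_coef_le_norm[of f j], of "\<bar>coef f j\<bar>"] assms
    by (simp add: norm_mult power2_eq_square)
  have "(\<lambda>j. (norm (z * of_real (coef f j)))\<^sup>2) summable_on UNIV"
    by (rule summable_on_comparison_test[OF s]) (use le in auto)
  then have "(\<Sum>\<^sub>\<infinity>j. (norm (z * of_real (coef f j)))\<^sup>2) \<le> (\<Sum>\<^sub>\<infinity>j. norm f * \<bar>coef f j\<bar>)"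
    by (intro infsum_mono s le)
  also have "\<dots> = (norm f)\<^sup>2"
    by (simp add: infsum_cmult_right' norm_l1_def power2_eq_square)
  finally show ?thesis
    unfolding l2_norm_def by (intro real_le_lsqrt) auto
qed

lemma phase_axis: "phase lam j (x + s *\<^sub>R axis k 1) = phase lam j x + s * int_inner (j $ k) (lam $ k)"
proof -
  have "phase lam j (x + s *\<^sub>R axis k 1)
      = (\<Sum>l\<in>UNIV. int_inner (j $ l) (lam $ l) * x $ l + (if l = k then s * int_inner (j $ k) (lam $ k) else 0))"
    unfolding phase_def by (rule sum.cong) (auto simp: axis_def algebra_simps)
  then show ?thesis by (simp add: sum.distrib phase_def)
qed

lemma has_sum_finite_sum:
  fixes f :: "'k \<Rightarrow> 'j \<Rightarrow> complex"
  assumes "finite K" "\<And>k. k \<in> K \<Longrightarrow> (f k has_sum s k) A"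
  shows "((\<lambda>j. \<Sum>k\<in>K. f k j) has_sum (\<Sum>k\<in>K. s k)) A"
  using assms by (induction K) (auto intro!: has_sum_add)

text \<open>
  The equation for the coefficients is what the nonlinear equation becomes after separating the time
  factor. It also provides the regularity: the right-hand side is summable, hence so are the
  coefficients multiplied by \<open>freq_sq\<close>, which dominates all second order frequency products.
\<close>
lemma standing_wave_solution:
  fixes f :: "(int^2^'d) l1"
  assumes flip: "flip_invariant f"
    and eq: "\<And>j. freq_sq j lam * coef f j = E * coef f j + coef (f ^ (2 * p + 1)) j"
  shows "NLS_solution p (\<lambda>t x. exp (- \<i> * of_real (E * t)) * l1_eval (plane_wave lam x) f)"
proof -
  define \<omega> where "\<omega> k j = int_inner (j $ k) (lam $ k)" for k and j :: "int^2^'d"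
  define A where "A t = exp (- \<i> * of_real (E * t))" for t
  define c :: "int^2^'d \<Rightarrow> complex" where "c j = of_real (coef f j)" for j
  define F where "F g x = (\<Sum>\<^sub>\<infinity>j. g j * cis (phase lam j x))" for g x
  let ?D = "\<lambda>k j. \<i> * of_real (\<omega> k j) * c j"
  let ?D2 = "\<lambda>k l j. \<i> * of_real (\<omega> l j) * (\<i> * of_real (\<omega> k j) * c j)"
  have u: "l1_eval (plane_wave lam x) f = F c x" for x
    by (simp add: l1_eval_def F_def c_def)
  have freq: "freq_sq j lam = (\<Sum>k\<in>UNIV. (\<omega> k j)\<^sup>2)" for j
    by (simp add: freq_sq_def \<omega>_def)
  have \<omega>le: "(\<omega> k j)\<^sup>2 \<le> freq_sq j lam" for k j
    unfolding freq by (rule member_le_sum) auto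
  have sc: "(\<lambda>j. norm (c j)) summable_on UNIV"
    by (simp add: c_def coef_abs_summable)
  have sf: "(\<lambda>j. freq_sq j lam * \<bar>coef f j\<bar>) summable_on UNIV"
  proof -
    have "(\<lambda>j. freq_sq j lam * coef f j) summable_on UNIV"
      unfolding eq by (intro summable_on_add summable_on_cmult_right coef_summable)
    then have "(\<lambda>j. \<bar>freq_sq j lam * coef f j\<bar>) summable_on UNIV"
      by (simp only: abs_summable_real_iff)
    moreover have "freq_sq j lam \<ge> 0" for j by (simp add: freq sum_nonneg)
    ultimately show ?thesis by (simp add: abs_mult)
  qed
  have bound: "(\<lambda>j. g j) summable_on UNIV"
    if "\<And>j. 0 \<le> g j" "\<And>j. g j \<le> (1 + freq_sq j lam) * \<bar>coef f j\<bar>" for g :: "int^2^'d \<Rightarrow> real"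
    by (rule summable_on_comparison_test[where f = "\<lambda>j. \<bar>coef f j\<bar> + freq_sq j lam * \<bar>coef f j\<bar>"])
      (use that in \<open>auto simp: distrib_right intro!: summable_on_add coef_abs_summable sf\<close>)
  have lin: "\<bar>\<omega> k j\<bar> \<le> 1 + freq_sq j lam" for k j
  proof -
    have "2 * \<bar>\<omega> k j\<bar> \<le> 1 + (\<omega> k j)\<^sup>2"
      using zero_le_power2[of "\<bar>\<omega> k j\<bar> - 1"] by (simp add: power2_diff)
    then show ?thesis using \<omega>le[of k j] zero_le_power2[of "\<omega> k j"] by linarith
  qed
  have quad: "\<bar>\<omega> k j\<bar> * \<bar>\<omega> l j\<bar> \<le> 1 + freq_sq j lam" for k l j
  proof -
    have "2 * (\<bar>\<omega> k j\<bar> * \<bar>\<omega> l j\<bar>) \<le> (\<omega> k j)\<^sup>2 + (\<omega> l j)\<^sup>2"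
      using zero_le_power2[of "\<bar>\<omega> k j\<bar> - \<bar>\<omega> l j\<bar>"] by (simp add: power2_diff mult.assoc)
    then show ?thesis using \<omega>le[of k j] \<omega>le[of l j] by linarith
  qed
  have s\<omega>: "(\<lambda>j. norm (c j) * \<bar>\<omega> k j\<bar>) summable_on UNIV" for k
    using mult_right_mono[OF lin[of k], of "\<bar>coef f _\<bar>"]
    by (intro bound) (simp_all add: c_def mult.commute)
  have sD: "(\<lambda>j. norm (?D k j)) summable_on UNIV" for k
    using s\<omega>[of k] by (simp add: norm_mult mult.commute)
  have sD\<omega>: "(\<lambda>j. norm (?D k j) * \<bar>\<omega> l j\<bar>) summable_on UNIV" for k l
  proof (rule bound)
    fix j
    show "norm (?D k j) * \<bar>\<omega> l j\<bar> \<le> (1 + freq_sq j lam) * \<bar>coef f j\<bar>"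
      using mult_right_mono[OF quad[of k j l], of "\<bar>coef f j\<bar>"] by (simp add: norm_mult c_def mult_ac)
  qed simp
  have sD2: "(\<lambda>j. norm (?D2 k l j)) summable_on UNIV" for k l
    using sD\<omega>[of k l] by (simp add: norm_mult mult_ac)
  have contF: "continuous_on UNIV (F g)" if "(\<lambda>j. norm (g j)) summable_on UNIV" for g
    unfolding F_def[abs_def] phase_def
    by (rule continuous_on_trig_series[OF that]) (intro continuous_intros)
  have contA: "continuous_on UNIV A"
    unfolding A_def by (intro continuous_intros)
  have cont: "continuous_on UNIV (\<lambda>(t, x). z * A t * F g x)" if "(\<lambda>j. norm (g j)) summable_on UNIV" for g z
    unfolding case_prod_unfold
    by (intro continuous_intros continuous_on_compose2[OF contA] continuous_on_compose2[OF contF[OF that]]) auto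
  have dF: "((\<lambda>s. F g (x + s *\<^sub>R axis k 1)) has_vector_derivative F (\<lambda>j. \<i> * of_real (\<omega> k j) * g j) x) (at 0)"
    if "(\<lambda>j. norm (g j)) summable_on UNIV" "(\<lambda>j. norm (g j) * \<bar>\<omega> k j\<bar>) summable_on UNIV" for g k x
    unfolding F_def phase_axis using trig_series_has_vector_derivative[OF that] by (simp add: \<omega>_def)
  have dA: "(A has_vector_derivative - \<i> * of_real E * A t) (at t)" for t
  proof -
    have "((\<lambda>t. exp (- \<i> * of_real E * t)) has_field_derivative - \<i> * of_real E * A t) (at (of_real t))"
      unfolding A_def by (auto intro!: derivative_eq_intros simp: algebra_simps)
    from has_vector_derivative_real_field[OF this] show ?thesis
      unfolding A_def by (simp add: mult.assoc)
  qed
  have normA: "norm (A t) = 1" for t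
    unfolding A_def by (simp add: norm_exp_eq_Re)
  \<comment> \<open>the series is real valued, so the even power of its modulus is a power of the series itself\<close>
  have nonlin: "of_real (norm (F c x) ^ (2 * p)) * F c x = l1_eval (plane_wave lam x) (f ^ (2 * p + 1))" for x
  proof -
    obtain r where r: "F c x = of_real r"
      using l1_eval_real[OF flip, of lam x] unfolding u by (auto elim: Reals_cases)
    then show ?thesis
      unfolding plane_eval_power u by (simp add: power_even_abs flip: of_real_power)
  qed
  have hasF: "((\<lambda>j. g j * cis (phase lam j x)) has_sum F g x) UNIV"
    if "(\<lambda>j. norm (g j)) summable_on UNIV" for g x
  proof -
    have "(\<lambda>j. norm (g j * cis (phase lam j x))) summable_on UNIV"
      using that by (simp only: norm_mult norm_cis mult_1_right)
    then show ?thesis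
      unfolding F_def by (rule has_sum_infsum[OF abs_summable_summable])
  qed
  have lap: "(\<Sum>k\<in>UNIV. F (?D2 k k) x) = - of_real E * F c x - l1_eval (plane_wave lam x) (f ^ (2 * p + 1))" for x
  proof -
    have "((\<lambda>j. \<Sum>k\<in>UNIV. ?D2 k k j * cis (phase lam j x)) has_sum (\<Sum>k\<in>UNIV. F (?D2 k k) x)) UNIV"
      by (rule has_sum_finite_sum[OF finite hasF[OF sD2]])
    moreover have "(\<Sum>k\<in>UNIV. ?D2 k k j * cis (phase lam j x))
        = - of_real E * (of_real (coef f j) * cis (phase lam j x))
          - of_real (coef (f ^ (2 * p + 1)) j) * cis (phase lam j x)" for j
    proof -
      have "(\<Sum>k\<in>UNIV. ?D2 k k j * cis (phase lam j x))
          = - of_real (freq_sq j lam * coef f j) * cis (phase lam j x)"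
        by (simp add: freq c_def sum_distrib_left sum_distrib_right sum_negf power2_eq_square mult_ac)
      then show ?thesis by (simp add: eq algebra_simps)
    qed
    ultimately have "((\<lambda>j. - of_real E * (of_real (coef f j) * cis (phase lam j x))
          + - 1 * (of_real (coef (f ^ (2 * p + 1)) j) * cis (phase lam j x))) has_sum (\<Sum>k\<in>UNIV. F (?D2 k k) x)) UNIV"
      by simp
    moreover have "((\<lambda>j. - of_real E * (of_real (coef f j) * cis (phase lam j x))
          + - 1 * (of_real (coef (f ^ (2 * p + 1)) j) * cis (phase lam j x))) has_sum
        (- of_real E * l1_eval (plane_wave lam x) f + - 1 * l1_eval (plane_wave lam x) (f ^ (2 * p + 1)))) UNIV"
      by (intro has_sum_add has_sum_cmult_right plane_eval_has_sum)
    ultimately show ?thesis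
      using has_sum_unique by (fastforce simp: u)
  qed
  show ?thesis
    unfolding NLS_solution_def schroedinger_solution_def u A_def[symmetric]
  proof (intro exI[of _ "\<lambda>t x. - \<i> * of_real E * A t * F c x"] exI[of _ "\<lambda>k t x. A t * F (?D k) x"]
      exI[of _ "\<lambda>k l t x. A t * F (?D2 k l) x"] conjI allI)
    fix t x k l
    show "((\<lambda>s. A s * F c x) has_vector_derivative - \<i> * of_real E * A t * F c x) (at t)"
      by (intro has_vector_derivative_mult_left dA)
    show "((\<lambda>s. A t * F c (x + s *\<^sub>R axis k 1)) has_vector_derivative A t * F (?D k) x) (at 0)"
      by (intro has_vector_derivative_mult_right dF sc s\<omega>)
    show "((\<lambda>s. A t * F (?D k) (x + s *\<^sub>R axis l 1)) has_vector_derivative A t * F (?D2 k l) x) (at 0)"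
      by (intro has_vector_derivative_mult_right dF sD sD\<omega>)
    show "continuous_on UNIV (\<lambda>(t, x). A t * F c x)"
      using cont[OF sc, of 1] by simp
    show "continuous_on UNIV (\<lambda>(t, x). - \<i> * of_real E * A t * F c x)"
      by (rule cont[OF sc])
    show "continuous_on UNIV (\<lambda>(t, x). A t * F (?D k) x)"
      using cont[OF sD, of 1] by simp
    show "continuous_on UNIV (\<lambda>(t, x). A t * F (?D2 k l) x)"
      using cont[OF sD2, of 1] by simp
    have "of_real (norm (A t * F c x) ^ (2 * p)) * (A t * F c x)
        = A t * (of_real (norm (F c x) ^ (2 * p)) * F c x)"
      by (simp add: norm_mult normA)
    also have "\<dots> = A t * l1_eval (plane_wave lam x) (f ^ (2 * p + 1))"
      by (simp only: nonlin)
    finally have "of_real (norm (A t * F c x) ^ (2 * p)) * (A t * F c x)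
        = A t * l1_eval (plane_wave lam x) (f ^ (2 * p + 1))" .
    then show "\<i> * (- \<i> * of_real E * A t * F c x) = - (\<Sum>k\<in>UNIV. A t * F (?D2 k k) x)
        - of_real (norm (A t * F c x) ^ (2 * p)) * (A t * F c x)"
      unfolding sum_distrib_left[symmetric] lap by (simp add: algebra_simps)
  qed
qed

section \<open>The profile on the odd multiples\<close>

text \<open>
  The coefficients of the cosine mode of \<open>jt\<close>, written as an exponential series.
\<close>
definition orbit_mean :: "int^2^'d \<Rightarrow> (int^2^'d) l1" where
  "orbit_mean jt = Abs_l1 (\<lambda>j. if j \<in> sign_orbit jt then 1 / real (card (sign_orbit jt)) else 0)"

lemma coef_orbit_mean:
  "coef (orbit_mean jt) j = (if j \<in> sign_orbit jt then 1 / real (card (sign_orbit jt)) else 0)"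
proof -
  have "(\<lambda>j. if j \<in> sign_orbit jt then 1 / real (card (sign_orbit jt)) else 0) summable_on UNIV"
    by (rule finite_nonzero_values_imp_summable_on)
      (rule finite_subset[OF _ finite_sign_orbit[of jt]], auto)
  then show ?thesis
    unfolding orbit_mean_def by (subst Abs_l1_inverse) auto
qed

lemma card_sign_orbit_pos: "card (sign_orbit jt) > 0"
  using sign_orbit_self finite_sign_orbit by (auto simp: card_gt_0_iff)

lemma flip_invariant_orbit_mean: "flip_invariant (orbit_mean jt)"
  by (simp add: flip_invariant_def coef_orbit_mean flip_sign_orbit)

lemma cos_mode_flip: "cos_mode lam (flip k j) x = cos_mode lam j x"
  unfolding cos_mode_def by (rule prod.cong) (auto simp: flip_nth int_inner_uminus)

lemma l1_eval_orbit_mean: "l1_eval (plane_wave lam x) (orbit_mean jt) = of_real (cos_mode lam jt x)"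
proof (rule has_sum_unique)
  show "((\<lambda>j. of_real (coef (orbit_mean jt) j) * of_real (cos_mode lam j x)) has_sum
      l1_eval (plane_wave lam x) (orbit_mean jt)) UNIV"
    using cosine_series_l1_eval[OF flip_invariant_orbit_mean] by (auto simp: cosine_series_def)
  have "(\<Sum>j\<in>sign_orbit jt. of_real (coef (orbit_mean jt) j) * of_real (cos_mode lam j x))
      = (\<Sum>j\<in>sign_orbit jt. complex_of_real (1 / real (card (sign_orbit jt))) * of_real (cos_mode lam jt x))"
    using sign_orbit_invariant[of "\<lambda>j. cos_mode lam j x", OF cos_mode_flip]
    by (intro sum.cong) (auto simp: coef_orbit_mean)
  also have "\<dots> = of_real (cos_mode lam jt x)"
    using card_sign_orbit_pos[of jt] by simp
  finally show "((\<lambda>j. of_real (coef (orbit_mean jt) j) * of_real (cos_mode lam j x)) has_sum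
      complex_of_real (cos_mode lam jt x)) UNIV"
    by (intro has_sum_finite_neutralI[OF finite_sign_orbit]) (auto simp: coef_orbit_mean)
qed

lemma flip_invariant_power: "flip_invariant f \<Longrightarrow> flip_invariant (f ^ n)"
  unfolding flip_invariant_def by (intro allI coef_power_invariant flip_add flip_flip) simp

lemma flip_invariant_add: "flip_invariant f \<Longrightarrow> flip_invariant g \<Longrightarrow> flip_invariant (f + g)"
  by (simp add: flip_invariant_def coef_simps)

lemma flip_invariant_diff: "flip_invariant f \<Longrightarrow> flip_invariant g \<Longrightarrow> flip_invariant (f - g)"
  by (simp add: flip_invariant_def coef_simps)

lemma flip_invariant_scaleR: "flip_invariant f \<Longrightarrow> flip_invariant (c *\<^sub>R f)"
  by (simp add: flip_invariant_def coef_simps)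

lemmas flip_invariant_linear = flip_invariant_add flip_invariant_diff flip_invariant_scaleR

lemma closed_flip_invariant: "closed {f. flip_invariant f}"
  unfolding flip_invariant_def
  by (intro closed_Collect_all closed_Collect_eq bounded_linear.continuous_on[OF bounded_linear_coef] continuous_on_id)

lemma root_close_to_one:
  assumes "t \<ge> 0" "n > 0"
  shows "\<bar>root n t - 1\<bar> \<le> \<bar>t - 1\<bar>"
proof -
  define r where "r = root n t"
  have r: "r \<ge> 0" "t = r ^ n" using assms by (simp_all add: r_def)
  have "\<bar>r - 1\<bar> \<le> \<bar>r ^ n - 1\<bar>"
  proof (cases "r \<ge> 1")
    case True
    then have "r \<le> r ^ n" using assms by (intro self_le_power) auto
    then show ?thesis using True by simp
  next
    case False
    then have "r ^ n \<le> r" using assms r power_decreasing[of 1 n r] by simp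
    then show ?thesis using False by simp
  qed
  then show ?thesis unfolding r(2)[symmetric] unfolding r_def .
qed

text \<open>
  The coefficient of the cosine mode of \<open>jt\<close> in its own power of order \<open>2 * p + 1\<close>. To leading order
  the nonlinear eigenvalue is shifted by this number times \<open>- \<bar>a\<bar>^(2 * p)\<close>.
\<close>
definition first_freq_shift :: "int^2^'d \<Rightarrow> nat \<Rightarrow> real" where
  "first_freq_shift jt p = real (card (sign_orbit jt)) * coef (orbit_mean jt ^ (2 * p + 1)) jt"

lemma first_freq_shift_pos: "first_freq_shift jt p > 0"
proof -
  have "coef (orbit_mean jt ^ (2 * p + 1)) jt > 0"
    by (rule coef_odd_power_pos)
      (use card_sign_orbit_pos[of jt] in \<open>auto simp: coef_orbit_mean sign_orbit_self\<close>)
  then show ?thesis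
    unfolding first_freq_shift_def using card_sign_orbit_pos[of jt] by simp
qed

text \<open>
  The stationary problem for a profile \<open>v\<close> close to the cosine mode, at the prescribed eigenvalue
  \<open>freq_sq jt lam - \<tau>\<close>. By homogeneity the amplitude may be left open: the nonlinear term carries the
  factor \<open>\<tau> / \<mu>\<close>, and rescaling \<open>v\<close> absorbs it later. The number \<open>\<mu>\<close> is the projection of the
  nonlinear term on the cosine mode, which makes the equation hold on the sign orbit. On the
  remaining odd multiples the equation is inverted by a multiplier with symbol
  \<open>\<tau> / (freq_sq j lam - freq_sq jt lam)\<close>, which is bounded by \<open>\<kappa>\<close>; at all other modes both sides
  vanish by parity.
\<close>
lemma odd_lattice_profile:
  fixes jt :: "int^2^'d" and p :: nat
  defines "N \<equiv> real (card (sign_orbit jt))" and "c0 \<equiv> first_freq_shift jt p"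
  shows "\<exists>K>0. \<exists>\<kappa>0>0. \<forall>\<kappa> \<delta> \<tau> lam.
    0 \<le> \<kappa> \<longrightarrow> \<kappa> \<le> \<kappa>0 \<longrightarrow> 0 \<le> \<tau> \<longrightarrow> \<tau> \<le> \<kappa> * (8 * \<delta>\<^sup>2) \<longrightarrow> 0 \<le> \<delta> \<longrightarrow>
    (\<forall>k. jt $ k \<noteq> 0 \<longrightarrow> \<delta> \<le> \<bar>int_inner (jt $ k) (lam $ k)\<bar>) \<longrightarrow>
    (\<exists>v \<mu>. flip_invariant v \<and> norm (v - orbit_mean jt) \<le> K * \<kappa> \<and> \<mu> > 0 \<and> \<bar>\<mu> - c0\<bar> \<le> K * \<kappa> \<and>
      (\<forall>j. freq_sq j lam * coef v j
         = (freq_sq jt lam - \<tau>) * coef v j + \<tau> / \<mu> * coef (v ^ (2 * p + 1)) j))"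
proof -
  define \<phi> where "\<phi> = orbit_mean jt"
  define l where "l f = N * coef f jt" for f :: "(int^2^'d) l1"
  define n where "n = 2 * p + 1"
  define S where "S = parity_multiples jt 1 - sign_orbit jt"
  have N: "N > 0" unfolding N_def using card_sign_orbit_pos by simp
  have l: "bounded_linear l"
    unfolding l_def by (intro bounded_linear_const_mult bounded_linear_coef)
  have c0: "l (\<phi> ^ n) = c0"
    by (simp only: c0_def l_def \<phi>_def n_def N_def first_freq_shift_def)
  have "l (\<phi> ^ n) > 0"
    unfolding c0 c0_def by (rule first_freq_shift_pos)
  from normalized_power_fixpoint[OF l this] obtain K \<kappa>0 where K: "K > 0" and \<kappa>0: "\<kappa>0 > 0" and contraction:
    "\<forall>\<kappa> M X. 0 \<le> \<kappa> \<longrightarrow> \<kappa> \<le> \<kappa>0 \<longrightarrow> linear M \<longrightarrow> (\<forall>f. norm (M f) \<le> \<kappa> * norm f) \<longrightarrow>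
      closed X \<longrightarrow> 0 \<in> X \<longrightarrow> (\<forall>w\<in>X. M ((\<phi> + w) ^ n /\<^sub>R l ((\<phi> + w) ^ n) - w) \<in> X) \<longrightarrow>
      (\<exists>w\<in>X. w = M ((\<phi> + w) ^ n /\<^sub>R l ((\<phi> + w) ^ n) - w) \<and> norm w \<le> K * \<kappa> \<and>
         l ((\<phi> + w) ^ n) > 0 \<and> \<bar>l ((\<phi> + w) ^ n) - l (\<phi> ^ n)\<bar> \<le> K * \<kappa>)"
    by - (elim exE conjE, rule that)
  have main: "\<exists>v \<mu>. flip_invariant v \<and> norm (v - \<phi>) \<le> K * \<kappa> \<and> \<mu> > 0 \<and> \<bar>\<mu> - c0\<bar> \<le> K * \<kappa> \<and>
      (\<forall>j. freq_sq j lam * coef v j = (freq_sq jt lam - \<tau>) * coef v j + \<tau> / \<mu> * coef (v ^ n) j)"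
    if \<kappa>: "0 \<le> \<kappa>" "\<kappa> \<le> \<kappa>0" and \<tau>: "0 \<le> \<tau>" "\<tau> \<le> \<kappa> * (8 * \<delta>\<^sup>2)" and \<delta>: "0 \<le> \<delta>"
      "\<And>k. jt $ k \<noteq> 0 \<Longrightarrow> \<delta> \<le> \<bar>int_inner (jt $ k) (lam $ k)\<bar>"
    for \<kappa> \<delta> \<tau> and lam :: "real^2^'d"
  proof -
    define m where "m j = (if j \<in> S then \<tau> / (freq_sq j lam - freq_sq jt lam) else 0)" for j
    have gap: "8 * \<delta>\<^sup>2 \<le> freq_sq j lam - freq_sq jt lam" if "j \<in> S" for j
      using freq_sq_gap[OF _ _ \<delta>] that by (simp add: S_def)
    \<comment> \<open>a vanishing gap forces \<open>\<delta> = 0\<close> and hence \<open>\<tau> = 0\<close>\<close>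
    have mul: "(freq_sq j lam - freq_sq jt lam) * m j = \<tau>" if "j \<in> S" for j
    proof (cases "freq_sq j lam - freq_sq jt lam = 0")
      case True
      then have "\<tau> = 0" using gap[OF that] \<tau> \<kappa> by (auto simp: mult_le_0_iff)
      then show ?thesis by (simp add: m_def)
    qed (use that in \<open>simp add: m_def\<close>)
    have m: "\<bar>m j\<bar> \<le> \<kappa>" for j
    proof (cases "j \<in> S \<and> freq_sq j lam - freq_sq jt lam \<noteq> 0")
      case True
      then have "0 < freq_sq j lam - freq_sq jt lam"
        using gap[of j] zero_le_power2[of \<delta>] by linarith
      moreover have "\<tau> \<le> \<kappa> * (freq_sq j lam - freq_sq jt lam)"
        using \<tau>(2) mult_left_mono[OF gap \<kappa>(1), of j] True by linarith
      ultimately show ?thesis using True \<tau> by (simp add: m_def divide_le_eq)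
    qed (use \<kappa> in \<open>auto simp: m_def\<close>)
    note M = coef_multiplier[of m \<kappa>, OF m] norm_multiplier_le[of m \<kappa>, OF m] linear_multiplier[of m \<kappa>, OF m]
    have mflip: "m (flip k j) = m j" for k j
      by (simp add: m_def S_def flip_parity_multiples flip_sign_orbit freq_sq_flip)
    have inv: "flip_invariant (l1_multiplier m f)" if "flip_invariant f" for f
      using that by (simp add: flip_invariant_def M(1) mflip)
    have "\<exists>w\<in>{f. flip_invariant f}. w = l1_multiplier m ((\<phi> + w) ^ n /\<^sub>R l ((\<phi> + w) ^ n) - w) \<and>
        norm w \<le> K * \<kappa> \<and> l ((\<phi> + w) ^ n) > 0 \<and> \<bar>l ((\<phi> + w) ^ n) - l (\<phi> ^ n)\<bar> \<le> K * \<kappa>"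
    proof (rule contraction[rule_format, OF \<kappa> M(3) M(2) closed_flip_invariant])
      show "0 \<in> {f. flip_invariant f}"
        by (simp add: flip_invariant_def coef_simps)
      show "l1_multiplier m ((\<phi> + w) ^ n /\<^sub>R l ((\<phi> + w) ^ n) - w) \<in> {f. flip_invariant f}"
        if "w \<in> {f. flip_invariant f}" for w
        using that
        by (auto simp: \<phi>_def intro!: inv flip_invariant_linear flip_invariant_power flip_invariant_orbit_mean)
    qed
    then obtain w where w: "flip_invariant w" "norm w \<le> K * \<kappa>"
      "w = l1_multiplier m ((\<phi> + w) ^ n /\<^sub>R l ((\<phi> + w) ^ n) - w)"
      "l ((\<phi> + w) ^ n) > 0" "\<bar>l ((\<phi> + w) ^ n) - c0\<bar> \<le> K * \<kappa>"
      unfolding c0 by blast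
    define v where "v = \<phi> + w"
    define \<mu> where "\<mu> = l (v ^ n)"
    have \<mu>: "\<mu> > 0" using w(4) by (simp add: \<mu>_def v_def)
    have wj: "coef w j = m j * (coef (v ^ n) j / \<mu> - coef w j)" for j
      using arg_cong[OF w(3), of "\<lambda>f. coef f j"]
      by (simp add: M(1) coef_simps \<mu>_def v_def divide_inverse mult.commute)
    have vinv: "flip_invariant v"
      unfolding v_def \<phi>_def by (intro flip_invariant_linear flip_invariant_orbit_mean w)
    have vsupp: "j \<in> parity_multiples jt 1" if "coef v j \<noteq> 0" for j
    proof (rule ccontr)
      assume j: "\<not> ?thesis"
      then have "j \<notin> sign_orbit jt" "j \<notin> S" using sign_orbit_subset by (auto simp: S_def)
      then have "coef v j = 0"
        using wj[of j] by (simp add: v_def coef_simps \<phi>_def coef_orbit_mean m_def)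
      then show False using that by simp
    qed
    have eq: "freq_sq j lam * coef v j = (freq_sq jt lam - \<tau>) * coef v j + \<tau> / \<mu> * coef (v ^ n) j" for j
    proof -
      consider "j \<in> S" | "j \<in> sign_orbit jt" | "j \<notin> parity_multiples jt 1"
        by (auto simp: S_def)
      then show ?thesis
      proof cases
        case 1
        then have "coef v j = coef w j"
          by (simp add: v_def coef_simps \<phi>_def coef_orbit_mean S_def)
        moreover have "(freq_sq j lam - freq_sq jt lam) * coef w j = \<tau> * (coef (v ^ n) j / \<mu> - coef w j)"
          by (subst wj) (simp only: mul[OF 1] flip: mult.assoc)
        ultimately show ?thesis by (simp add: algebra_simps)
      next
        case 2
        then have "m j = 0" by (simp add: m_def S_def)
        then have "coef w j = 0" using wj[of j] by simp
        then have vj: "coef v j = 1 / N"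
          using 2 by (simp add: v_def coef_simps \<phi>_def coef_orbit_mean N_def)
        have "freq_sq j lam = freq_sq jt lam"
          by (rule sign_orbit_invariant[of "\<lambda>j. freq_sq j lam", OF freq_sq_flip 2])
        moreover have "coef (v ^ n) j = coef (v ^ n) jt"
        proof (rule sign_orbit_invariant[OF _ 2])
          show "coef (v ^ n) (flip k i) = coef (v ^ n) i" for k i
            using flip_invariant_power[OF vinv, of n] by (simp add: flip_invariant_def)
        qed
        moreover have "coef (v ^ n) jt = \<mu> / N"
          using N by (simp add: \<mu>_def l_def)
        ultimately show ?thesis using \<mu> by (simp add: vj algebra_simps)
      next
        case 3
        then have "coef v j = 0" using vsupp by blast
        moreover have "coef (v ^ n) j = 0"
        proof (rule ccontr)
          assume "coef (v ^ n) j \<noteq> 0"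
          then have "j \<in> parity_multiples jt n"
            by (rule coef_power_support[of v "parity_multiples jt", rotated 3])
              (use vsupp zero_in_parity_multiples parity_multiples_add in auto)
          then show False using 3 by (simp add: parity_multiples_def n_def)
        qed
        ultimately show ?thesis by simp
      qed
    qed
    show ?thesis
      using vinv w(2,5) \<mu> eq by (intro exI[of _ v] exI[of _ \<mu>]) (simp add: \<mu>_def v_def)
  qed
  show ?thesis
  proof (rule exI[of _ K], rule conjI[OF K], rule exI[of _ \<kappa>0], rule conjI[OF \<kappa>0], intro allI impI)
    fix \<kappa> \<delta> \<tau> :: real and lam :: "real^2^'d"
    assume "0 \<le> \<kappa>" "\<kappa> \<le> \<kappa>0" "0 \<le> \<tau>" "\<tau> \<le> \<kappa> * (8 * \<delta>\<^sup>2)" "0 \<le> \<delta>"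
      "\<forall>k. jt $ k \<noteq> 0 \<longrightarrow> \<delta> \<le> \<bar>int_inner (jt $ k) (lam $ k)\<bar>"
    then show "\<exists>v \<mu>. flip_invariant v \<and> norm (v - orbit_mean jt) \<le> K * \<kappa> \<and> \<mu> > 0 \<and> \<bar>\<mu> - c0\<bar> \<le> K * \<kappa> \<and>
        (\<forall>j. freq_sq j lam * coef v j
           = (freq_sq jt lam - \<tau>) * coef v j + \<tau> / \<mu> * coef (v ^ (2 * p + 1)) j)"
      using main[of \<kappa> \<tau> \<delta> lam] unfolding \<phi>_def n_def by simp
  qed
qed

section \<open>Quasi-periodic standing waves\<close>

lemma cosine_series_cmult:
  "cosine_series lam c u \<Longrightarrow> cosine_series lam (\<lambda>j. z * c j) (\<lambda>x. z * u x)"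
  unfolding cosine_series_def mult.assoc by (intro allI has_sum_cmult_right) auto

theorem mainTheorem1:
  fixes p :: nat and jt :: "int^2^'d"
  assumes "p \<ge> 1"
  shows "\<exists>a0>0. \<exists>C>0. \<exists>\<eta>::real \<Rightarrow> real. (\<eta> \<longlongrightarrow> 0) (at 0) \<and>
    (\<forall>a::real. \<bar>a\<bar> < a0 \<longrightarrow>
      (\<exists>(\<Lambda> :: (real^2^'d) set) (E :: real^2^'d \<Rightarrow> real).
         \<Lambda> \<subseteq> param_cube \<and> (\<forall>lam\<in>\<Lambda>. irrational_param lam) \<and>
         \<Lambda> \<in> sets lebesgue \<and> measure lebesgue \<Lambda> \<ge> 1 - \<bar>a\<bar> powr (real p / 6) \<and>
         C1_on param_cube E \<and>
         (\<forall>lam\<in>\<Lambda>. \<exists>(U :: real \<Rightarrow> real^'d \<Rightarrow> complex) u uhat.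
            NLS_solution p U \<and>
            (\<forall>t x. U t x = exp (- \<i> * of_real (E lam * t)) * u x) \<and>
            cosine_series lam uhat u \<and>
            close_up_to_freq_shift lam (\<eta> a) (\<eta> a * \<bar>a\<bar>) U (linear_wave a jt lam) \<and>
            (\<exists>e r rhat. \<bar>e\<bar> \<le> C * \<bar>a\<bar> ^ (2 * p) \<and> E lam = freq_sq jt lam + e \<and>
               cosine_series lam rhat r \<and> l2_norm rhat \<le> C * \<bar>a\<bar> ^ p \<and>
               (\<forall>t x. U t x = exp (- \<i> * of_real ((freq_sq jt lam + e) * t)) *
                  (of_real (a * cos_mode lam jt x) + r x))))))"
proof -
  define \<phi> where "\<phi> = orbit_mean jt"
  define c0 where "c0 = first_freq_shift jt p"
  define d where "d = real CARD('d)"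
  have c0: "c0 > 0" by (simp add: c0_def first_freq_shift_pos)
  have d: "d \<ge> 1" by (simp add: d_def Suc_leI)
  obtain K \<kappa>0 where K: "K > 0" and \<kappa>0: "\<kappa>0 > 0" and profile:
    "\<forall>\<kappa> \<delta> \<tau> lam. 0 \<le> \<kappa> \<longrightarrow> \<kappa> \<le> \<kappa>0 \<longrightarrow> 0 \<le> \<tau> \<longrightarrow> \<tau> \<le> \<kappa> * (8 * \<delta>\<^sup>2) \<longrightarrow> 0 \<le> \<delta> \<longrightarrow>
      (\<forall>k. jt $ k \<noteq> 0 \<longrightarrow> \<delta> \<le> \<bar>int_inner (jt $ k) (lam $ k)\<bar>) \<longrightarrow>
      (\<exists>v \<mu>. flip_invariant v \<and> norm (v - \<phi>) \<le> K * \<kappa> \<and> \<mu> > 0 \<and> \<bar>\<mu> - c0\<bar> \<le> K * \<kappa> \<and>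
        (\<forall>j. freq_sq j lam * coef v j
           = (freq_sq jt lam - \<tau>) * coef v j + \<tau> / \<mu> * coef (v ^ (2 * p + 1)) j))"
    using odd_lattice_profile[of jt p] unfolding \<phi>_def[symmetric] c0_def[symmetric]
    by - (elim exE conjE, rule that)
  define Kd where "Kd = 2 * c0 * d\<^sup>2"
  define K2 where "K2 = (2 * K / c0 * norm \<phi> + 2 * K) * Kd"
  define C where "C = c0 + K2"
  define a0 where "a0 = min 1 (min (\<kappa>0 / Kd) (c0 / (2 * K * Kd)))"
  have Kd: "Kd > 0" using c0 d by (simp add: Kd_def)
  have K2: "K2 \<ge> 0" using K Kd c0 by (simp add: K2_def)
  have C: "C > 0" using c0 K2 by (simp add: C_def)
  have a0: "a0 > 0" using \<kappa>0 Kd K c0 by (simp add: a0_def)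
  define \<eta> where "\<eta> a = C * \<bar>a\<bar> ^ p" for a :: real
  have "(\<eta> \<longlongrightarrow> C * \<bar>0\<bar> ^ p) (at 0)"
    unfolding \<eta>_def by (intro tendsto_intros)
  then have \<eta>: "(\<eta> \<longlongrightarrow> 0) (at 0)" using assms by (simp add: power_0_left)
  show ?thesis
  proof (rule exI[of _ a0], rule conjI[OF a0], rule exI[of _ C], rule conjI[OF C],
      rule exI[of _ \<eta>], rule conjI[OF \<eta>], intro allI impI)
    fix a :: real
    assume a: "\<bar>a\<bar> < a0"
    define A where "A = \<bar>a\<bar>"
    define P where "P = A powr (real p / 6)"
    \<comment> \<open>with this width the removed strips have total measure at most \<open>P\<close>\<close>
    define \<delta> where "\<delta> = P / (4 * d)"
    define \<tau> where "\<tau> = c0 * A ^ (2 * p)"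
    define \<kappa> where "\<kappa> = Kd * A ^ p"
    \<comment> \<open>the shift does not depend on the parameter, so \<open>E\<close> is a polynomial\<close>
    define E where "E lam = freq_sq jt lam - \<tau>" for lam
    have A: "0 \<le> A" "A \<le> 1" using a by (simp_all add: A_def a0_def)
    have Ap: "A ^ p \<le> A" using power_decreasing[of 1 p A] assms A by simp
    have A2p: "A ^ (2 * p) \<le> A ^ p" using A by (intro power_decreasing) auto
    have \<delta>: "\<delta> \<ge> 0" using d by (simp add: \<delta>_def P_def)
    have \<tau>: "\<tau> \<ge> 0" using c0 A by (simp add: \<tau>_def)
    have \<kappa>: "0 \<le> \<kappa>" using Kd A by (simp add: \<kappa>_def)
    have \<kappa>A: "\<kappa> \<le> Kd * A" using Ap Kd by (simp add: \<kappa>_def)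
    have "A \<le> \<kappa>0 / Kd" "A \<le> c0 / (2 * K * Kd)" using a by (simp_all add: A_def a0_def)
    then have "Kd * A \<le> \<kappa>0" "K * (Kd * A) \<le> c0 / 2"
      using Kd K by (simp_all add: field_simps)
    then have \<kappa>le: "\<kappa> \<le> \<kappa>0" and K\<kappa>: "K * \<kappa> \<le> c0 / 2"
      using \<kappa>A mult_left_mono[OF \<kappa>A, of K] K by linarith+
    have PA: "A ^ p \<le> P\<^sup>2"
    proof (cases "A = 0")
      case True
      then show ?thesis using assms by (simp add: power_0_left)
    next
      case False
      then have "A ^ p = A powr real p" using A by (simp add: powr_realpow)
      also have "\<dots> \<le> A powr (real p / 6 + real p / 6)"
        using A by (intro powr_mono') auto
      also have "\<dots> = P\<^sup>2" by (simp only: P_def powr_add power2_eq_square)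
      finally show ?thesis .
    qed
    have \<tau>le: "\<tau> \<le> \<kappa> * (8 * \<delta>\<^sup>2)"
    proof -
      have "\<tau> = c0 * A ^ p * A ^ p" by (simp add: \<tau>_def mult_2 power_add)
      also have "\<dots> \<le> c0 * A ^ p * P\<^sup>2"
        using PA c0 A by (intro mult_left_mono) auto
      also have "\<dots> = \<kappa> * (8 * \<delta>\<^sup>2)"
        using d by (simp add: \<kappa>_def Kd_def \<delta>_def power_divide power_mult_distrib)
      finally show ?thesis .
    qed
    have sol: "\<exists>(U :: real \<Rightarrow> real^'d \<Rightarrow> complex) u uhat.
        NLS_solution p U \<and>
        (\<forall>t x. U t x = exp (- \<i> * of_real (E lam * t)) * u x) \<and>
        cosine_series lam uhat u \<and>
        close_up_to_freq_shift lam (\<eta> a) (\<eta> a * \<bar>a\<bar>) U (linear_wave a jt lam) \<and>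
        (\<exists>e r rhat. \<bar>e\<bar> \<le> C * \<bar>a\<bar> ^ (2 * p) \<and> E lam = freq_sq jt lam + e \<and>
           cosine_series lam rhat r \<and> l2_norm rhat \<le> C * \<bar>a\<bar> ^ p \<and>
           (\<forall>t x. U t x = exp (- \<i> * of_real ((freq_sq jt lam + e) * t)) *
              (of_real (a * cos_mode lam jt x) + r x)))"
      if lam: "lam \<in> nonresonant_params jt \<delta>" for lam
    proof -
      have "\<forall>k. jt $ k \<noteq> 0 \<longrightarrow> \<delta> \<le> \<bar>int_inner (jt $ k) (lam $ k)\<bar>"
        using lam by (simp add: nonresonant_params_def)
      then obtain v \<mu> where v: "flip_invariant v" "norm (v - \<phi>) \<le> K * \<kappa>"
        and \<mu>: "\<mu> > 0" "\<bar>\<mu> - c0\<bar> \<le> K * \<kappa>"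
        and eq: "\<And>j. freq_sq j lam * coef v j = (freq_sq jt lam - \<tau>) * coef v j + \<tau> / \<mu> * coef (v ^ (2 * p + 1)) j"
        using profile[rule_format, OF \<kappa> \<kappa>le \<tau> \<tau>le \<delta>, of lam] by auto
      \<comment> \<open>the amplitude that turns the factor \<open>\<tau> / \<mu>\<close> of the nonlinear term into 1\<close>
      define \<rho> where "\<rho> = root (2 * p) (c0 / \<mu>)"
      define b where "b = a * \<rho>"
      define f where "f = b *\<^sub>R v"
      define g where "g = f - a *\<^sub>R \<phi>"
      have "b ^ (2 * p) = \<tau> / \<mu>"
        using \<mu> c0 assms by (simp add: b_def \<rho>_def power_mult_distrib \<tau>_def A_def power_even_abs)
      then have bn: "b ^ (2 * p + 1) = b * (\<tau> / \<mu>)" by simp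
      have finv: "flip_invariant f"
        unfolding f_def by (intro flip_invariant_linear v)
      have ginv: "flip_invariant g"
        unfolding g_def \<phi>_def by (intro flip_invariant_linear finv flip_invariant_orbit_mean)
      have feq: "freq_sq j lam * coef f j = E lam * coef f j + coef (f ^ (2 * p + 1)) j" for j
        using arg_cong[OF eq[of j], of "\<lambda>z. b * z"]
        unfolding f_def scaleR_power bn coef_simps E_def by (simp add: algebra_simps)
      have \<rho>1: "\<bar>\<rho> - 1\<bar> \<le> 2 * K / c0 * \<kappa>"
      proof -
        have "\<bar>\<rho> - 1\<bar> \<le> \<bar>c0 / \<mu> - 1\<bar>"
          unfolding \<rho>_def using \<mu> c0 assms by (intro root_close_to_one) auto
        also have "\<dots> = \<bar>\<mu> - c0\<bar> / \<mu>"
          using \<mu>(1) by (simp add: field_simps abs_minus_commute)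
        also have "\<dots> \<le> K * \<kappa> / (c0 / 2)"
          using \<mu> K\<kappa> c0 K \<kappa> by (intro frac_le) auto
        finally show ?thesis using c0 by (simp add: field_simps)
      qed
      have "2 * K / c0 * \<kappa> \<le> 1" using K\<kappa> c0 by (simp add: field_simps)
      then have \<rho>2: "\<bar>\<rho>\<bar> \<le> 2" using \<rho>1 by linarith
      have gn: "norm g \<le> K2 * A ^ p * A"
      proof -
        have "g = (a * (\<rho> - 1)) *\<^sub>R \<phi> + (a * \<rho>) *\<^sub>R (v - \<phi>)"
          by (simp add: g_def f_def b_def algebra_simps)
        then have "norm g \<le> A * \<bar>\<rho> - 1\<bar> * norm \<phi> + A * \<bar>\<rho>\<bar> * norm (v - \<phi>)"
          using norm_triangle_ineq[of "(a * (\<rho> - 1)) *\<^sub>R \<phi>" "(a * \<rho>) *\<^sub>R (v - \<phi>)"]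
          by (simp add: abs_mult A_def)
        also have "\<dots> \<le> A * (2 * K / c0 * \<kappa>) * norm \<phi> + A * 2 * (K * \<kappa>)"
          using A \<rho>1 \<rho>2 v(2) K \<kappa> c0 by (intro add_mono mult_mono) auto
        also have "\<dots> = K2 * A ^ p * A"
          by (simp add: K2_def \<kappa>_def algebra_simps)
        finally show ?thesis .
      qed
      define u where "u x = l1_eval (plane_wave lam x) f" for x
      define r where "r x = l1_eval (plane_wave lam x) g" for x
      have ur: "u x = of_real (a * cos_mode lam jt x) + r x" for x
      proof -
        have "f = a *\<^sub>R \<phi> + g" by (simp add: g_def)
        then show ?thesis
          by (simp add: u_def r_def plane_eval_add plane_eval_scaleR \<phi>_def l1_eval_orbit_mean)
      qed
      have rser: "cosine_series lam (\<lambda>j. of_real (coef g j)) r"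
        using cosine_series_l1_eval[OF ginv] by (simp add: r_def[abs_def])
      define U where "U t x = exp (- \<i> * of_real (E lam * t)) * u x" for t x
      have nls: "NLS_solution p U"
        using standing_wave_solution[OF finv feq] by (simp add: U_def[abs_def] u_def)
      have close: "close_up_to_freq_shift lam (\<eta> a) (\<eta> a * \<bar>a\<bar>) U (linear_wave a jt lam)"
        unfolding close_up_to_freq_shift_def
      proof (intro exI[of _ "- \<tau>"] conjI allI)
        show "\<bar>- \<tau>\<bar> \<le> \<eta> a"
          using \<tau> mult_mono[of c0 C "A ^ (2 * p)" "A ^ p"] A2p c0 K2 A
          by (simp add: \<eta>_def \<tau>_def C_def A_def)
        fix t
        define z where "z = exp (- \<i> * of_real (freq_sq jt lam * t))"
        have z: "norm z = 1" by (simp add: z_def norm_exp_eq_Re)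
        have zE: "exp (\<i> * of_real (- \<tau> * t)) * exp (- \<i> * of_real (E lam * t)) = z"
          by (simp add: z_def E_def algebra_simps flip: exp_add)
        have "exp (\<i> * of_real (- \<tau> * t)) * U t x - linear_wave a jt lam t x = z * r x" for x
        proof -
          have "exp (\<i> * of_real (- \<tau> * t)) * U t x = z * u x"
            unfolding U_def zE[symmetric] by (simp only: mult.assoc)
          moreover have "linear_wave a jt lam t x = z * of_real (a * cos_mode lam jt x)"
            by (simp add: linear_wave_def z_def)
          ultimately show ?thesis by (simp add: ur algebra_simps)
        qed
        moreover have "l2_norm (\<lambda>j. z * of_real (coef g j)) \<le> \<eta> a * \<bar>a\<bar>"
        proof -
          have "K2 * A ^ p * A \<le> C * A ^ p * A"
            using c0 A by (intro mult_right_mono) (auto simp: C_def)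
          then show ?thesis
            using l2_norm_le_norm[OF z, of g] gn by (simp add: \<eta>_def A_def)
        qed
        ultimately show "\<exists>w. l2_norm w \<le> \<eta> a * \<bar>a\<bar> \<and>
            cosine_series lam w (\<lambda>x. exp (\<i> * of_real (- \<tau> * t)) * U t x - linear_wave a jt lam t x)"
          using cosine_series_cmult[OF rser, of z] by auto
      qed
      have rn: "l2_norm (\<lambda>j. complex_of_real (coef g j)) \<le> C * \<bar>a\<bar> ^ p"
      proof -
        have "K2 * A ^ p * A \<le> K2 * A ^ p * 1"
          using A K2 by (intro mult_left_mono) auto
        also have "\<dots> \<le> C * A ^ p"
          using c0 A by (simp add: C_def mult_right_mono)
        finally show ?thesis
          using l2_norm_le_norm[of 1 g] gn by (simp add: A_def)
      qed
      have e: "\<bar>- \<tau>\<bar> \<le> C * \<bar>a\<bar> ^ (2 * p)"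
        using \<tau> K2 A by (simp add: \<tau>_def C_def A_def mult_right_mono)
      show ?thesis
        using nls cosine_series_l1_eval[OF finv, of lam] close rser rn e
        by (intro exI[of _ U] exI[of _ u] exI[of _ "\<lambda>j. of_real (coef f j)"] conjI
            exI[of _ "- \<tau>"] exI[of _ r] exI[of _ "\<lambda>j. of_real (coef g j)"] allI)
          (simp_all add: U_def E_def u_def[abs_def] ur[unfolded u_def])
    qed
    have meas: "measure lebesgue (nonresonant_params jt \<delta>) \<ge> 1 - \<bar>a\<bar> powr (real p / 6)"
      using measure_nonresonant_params(2)[OF \<delta>, of jt] d by (simp add: \<delta>_def d_def P_def A_def)
    show "\<exists>(\<Lambda> :: (real^2^'d) set) (E :: real^2^'d \<Rightarrow> real).
         \<Lambda> \<subseteq> param_cube \<and> (\<forall>lam\<in>\<Lambda>. irrational_param lam) \<and>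
         \<Lambda> \<in> sets lebesgue \<and> measure lebesgue \<Lambda> \<ge> 1 - \<bar>a\<bar> powr (real p / 6) \<and>
         C1_on param_cube E \<and>
         (\<forall>lam\<in>\<Lambda>. \<exists>(U :: real \<Rightarrow> real^'d \<Rightarrow> complex) u uhat.
            NLS_solution p U \<and>
            (\<forall>t x. U t x = exp (- \<i> * of_real (E lam * t)) * u x) \<and>
            cosine_series lam uhat u \<and>
            close_up_to_freq_shift lam (\<eta> a) (\<eta> a * \<bar>a\<bar>) U (linear_wave a jt lam) \<and>
            (\<exists>e r rhat. \<bar>e\<bar> \<le> C * \<bar>a\<bar> ^ (2 * p) \<and> E lam = freq_sq jt lam + e \<and>
               cosine_series lam rhat r \<and> l2_norm rhat \<le> C * \<bar>a\<bar> ^ p \<and>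
               (\<forall>t x. U t x = exp (- \<i> * of_real ((freq_sq jt lam + e) * t)) *
                  (of_real (a * cos_mode lam jt x) + r x))))"
    proof (rule exI[of _ "nonresonant_params jt \<delta>"], rule exI[of _ E], intro conjI)
      show "C1_on param_cube E"
        unfolding E_def by (rule C1_on_freq_sq)
      show "nonresonant_params jt \<delta> \<in> sets lebesgue"
        by (rule measure_nonresonant_params(1)[OF \<delta>])
    qed (use sol meas in \<open>auto simp: nonresonant_params_def\<close>)
  qed
qed

end
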